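(* Let $C,C_1,C_2,\ldots$ be bivariate Archimedean copulas with generators $\varphi,\varphi_1,\varphi_2,\ldots$, respectively (each right-continuous at $0$ and normalized to take the value $1$ at $\frac12$). Then the following assertions are equivalent: (a) $\lim_{n\to\infty}C_n(x,y)=C(x,y)$ for all $x,y\in[0,1]$; (b) $\lim_{n\to\infty}F_n^{\mathrm{Kendall}}(x)=F^{\mathrm{Kendall}}(x)$ for all $x\in\mathrm{Cont}(D^+\varphi)$; (c) $\lim_{n\to\infty}\varphi_n(x)=\varphi(x)$ for all $x\in(0,1]$; (d) $\lim_{n\to\infty}D^+\varphi_n(x)=D^+\varphi(x)$ for all $x\in\mathrm{Cont}(D^+\varphi)$; (e) $\lim_{n\to\infty}D_1(C_n,C)=0$; (f) $C_n\xrightarrow{\mathrm{wcc}}C$ for $n\to\infty$.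
   Context: A generator is a convex and strictly decreasing function $\varphi:[0,1]\to[0,\infty]$ with $\varphi(1)=0$. Throughout, all generators are assumed to be right-continuous at $0$, i.e. $\varphi(0)=\varphi(0+):=\lim_{t\to0^+}\varphi(t)$, and normalized so that $\varphi(\frac12)=1$. The Archimedean copula induced by $\varphi$ is $C(x,y)=\varphi^{-}(\varphi(x)+\varphi(y))$, $x,y\in[0,1]$, where $\varphi^{-}:[0,\infty]\to[0,1]$ is the pseudoinverse: $\varphi^{-}(x)=\varphi^{-1}(x)$ for $x\in[0,\varphi(0+))$ and $\varphi^{-}(x)=0$ for $x\ge\varphi(0+)$. $D^+\varphi(x)$ denotes the right-hand derivative of $\varphi$ at $x\in(0,1)$, and $\mathrm{Cont}(D^+\varphi)\subseteq(0,1)$ denotes the set of all continuity points of $D^+\varphi$ in $(0,1)$ (by definition $0$ and $1$ are not included). $F^{\mathrm{Kendall}}$ and $F_n^{\mathrm{Kendall}}$ denote the Kendall distribution functions of $C$ and $C_n$, respectively; for an Archimedean copula with generator $\varphi$ the Kendall distribution function (the distribution function of $C(X,Y)$ for $(X,Y)\sim C$) is given on $(0,1)$ by $F^{\mathrm{Kendall}}(x)=x-\frac{\varphi(x)}{D^+\varphi(x)}$. $\lambda$ denotes the Lebesgue measure on $[0,1]$. For a copula $C$, $K_C:[0,1]\times\mathcal{B}([0,1])\to[0,1]$ denotes (a version of) its Markov kernel, i.e. the regular conditional distribution of $Y$ given $X$ where $(X,Y)$ has distribution function $C$; it is unique for $\lambda$-a.e. $x$. The metric $D_1$ on the family of all bivariate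 copulas is $$D_1(A,B)=\int_{[0,1]}\int_{[0,1]}|K_{A}(x,[0,y])-K_{B}(x,[0,y])|\,d\lambda(x)\,d\lambda(y).$$ Weak conditional convergence $C_n\xrightarrow{\mathrm{wcc}}C$ means: for $\lambda$-almost every $x\in[0,1]$ the probability measures $K_{C_n}(x,\cdot)$ on $\mathcal{B}([0,1])$ converge weakly to $K_C(x,\cdot)$. *)

theory Defs
  imports "HOL-Probability.Probability"
begin

section \<open>Generators and Archimedean copulas\<close>

text \<open>
  Only the values of a generator on the unit interval matter.  Convexity is written out because
  \<^const>\<open>convex_on\<close> is about real-valued functions, while a generator may take the
  value \<open>\<infinity>\<close> at \<open>0\<close>.  The last two conditions are the standing assumptions of right-continuity
  at \<open>0\<close> and of normalization.
\<close>

definition generator :: "(real \<Rightarrow> ennreal) \<Rightarrow> bool" where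
  "generator \<phi> \<longleftrightarrow>
     (\<forall>x\<in>{0..1}. \<forall>y\<in>{0..1}. \<forall>t\<in>{0..1}.
        \<phi> ((1 - t) * x + t * y) \<le> ennreal (1 - t) * \<phi> x + ennreal t * \<phi> y) \<and>
     strict_antimono_on {0..1} \<phi> \<and>
     \<phi> 1 = 0 \<and>
     (\<phi> \<longlongrightarrow> \<phi> 0) (at_right 0) \<and>
     \<phi> (1/2) = 1"

text \<open>For a generator, \<open>\<phi> 0\<close> is the right-hand limit \<open>\<phi>(0+)\<close>.\<close>

definition pseudo_inverse :: "(real \<Rightarrow> ennreal) \<Rightarrow> ennreal \<Rightarrow> real" where
  "pseudo_inverse \<phi> s = (if s < \<phi> 0 then the_inv_into {0..1} \<phi> s else 0)"

definition arch_copula :: "(real \<Rightarrow> ennreal) \<Rightarrow> real \<Rightarrow> real \<Rightarrow> real" where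
  "arch_copula \<phi> x y = pseudo_inverse \<phi> (\<phi> x + \<phi> y)"

text \<open>
  On \<open>(0,1]\<close> a generator is finite, so the conversion to the reals is harmless in the
  right-hand derivative at a point of \<open>(0,1)\<close>.
\<close>

definition right_deriv :: "(real \<Rightarrow> ennreal) \<Rightarrow> real \<Rightarrow> real" where
  "right_deriv \<phi> x =
     Lim (at_right x) (\<lambda>y. (enn2real (\<phi> y) - enn2real (\<phi> x)) / (y - x))"

definition cont_right_deriv :: "(real \<Rightarrow> ennreal) \<Rightarrow> real set" where
  "cont_right_deriv \<phi> = {x \<in> {0<..<1}. isCont (right_deriv \<phi>) x}"


section \<open>Laws, Kendall distribution functions and Markov kernels of copulas\<close>

definition unit_borel :: "real measure" where
  "unit_borel = restrict_space borel {0..1}"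

definition unit_lebesgue :: "real measure" where
  "unit_lebesgue = restrict_space lborel {0..1}"

text \<open>The law of \<open>(X, Y)\<close> with distribution function \<open>C\<close>; a pi-system argument shows uniqueness.\<close>

definition copula_law :: "(real \<Rightarrow> real \<Rightarrow> real) \<Rightarrow> (real \<times> real) measure" where
  "copula_law C = (THE \<mu>. prob_space \<mu> \<and>
     sets \<mu> = sets (unit_borel \<Otimes>\<^sub>M unit_borel) \<and>
     (\<forall>x\<in>{0..1}. \<forall>y\<in>{0..1}. measure \<mu> ({0..x} \<times> {0..y}) = C x y))"

text \<open>The distribution function of \<open>C(X, Y)\<close>.\<close>

definition kendall_cdf :: "(real \<Rightarrow> real \<Rightarrow> real) \<Rightarrow> real \<Rightarrow> real" where
  "kendall_cdf C = cdf (distr (copula_law C) borel (\<lambda>(x, y). C x y))"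

text \<open>
  A regular conditional distribution of \<open>Y\<close> given \<open>X\<close>.  The law of \<open>X\<close> is the uniform
  distribution on the unit interval because \<open>C\<close> is a copula.
\<close>

definition is_markov_kernel :: "(real \<Rightarrow> real \<Rightarrow> real) \<Rightarrow> (real \<Rightarrow> real measure) \<Rightarrow> bool" where
  "is_markov_kernel C K \<longleftrightarrow>
     K \<in> unit_borel \<rightarrow>\<^sub>M prob_algebra unit_borel \<and>
     (\<forall>E\<in>sets unit_borel. \<forall>F\<in>sets unit_borel.
        emeasure (copula_law C) (E \<times> F) = (\<integral>\<^sup>+x\<in>E. emeasure (K x) F \<partial>unit_lebesgue))"

text \<open>
  One version is selected; it is determined almost everywhere, so \<open>copula_D1\<close> and \<open>wcc\<close>
  below do not depend on the selection.
\<close>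

definition markov_kernel :: "(real \<Rightarrow> real \<Rightarrow> real) \<Rightarrow> real \<Rightarrow> real measure" where
  "markov_kernel C = (SOME K. is_markov_kernel C K)"

definition copula_D1 :: "(real \<Rightarrow> real \<Rightarrow> real) \<Rightarrow> (real \<Rightarrow> real \<Rightarrow> real) \<Rightarrow> real" where
  "copula_D1 A B =
     (\<integral>y. (\<integral>x. \<bar>measure (markov_kernel A x) {0..y} - measure (markov_kernel B x) {0..y}\<bar>
        \<partial>unit_lebesgue) \<partial>unit_lebesgue)"

text \<open>
  \<^const>\<open>weak_conv_m\<close> is about Borel probability measures on the whole real line, so the
  measures on the unit interval are pushed forward along the inclusion.
\<close>

definition wcc :: "(nat \<Rightarrow> real \<Rightarrow> real \<Rightarrow> real) \<Rightarrow> (real \<Rightarrow> real \<Rightarrow> real) \<Rightarrow> bool" where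
  "wcc Cs C \<longleftrightarrow>
     (AE x in unit_lebesgue.
        weak_conv_m (\<lambda>n. distr (markov_kernel (Cs n) x) borel (\<lambda>y. y))
                    (distr (markov_kernel C x) borel (\<lambda>y. y)))"


section \<open>Equivalence of a list of assertions\<close>

definition all_equivalent :: "bool list \<Rightarrow> bool" where
  "all_equivalent Ps \<longleftrightarrow> (\<forall>P\<in>set Ps. \<forall>Q\<in>set Ps. P \<longleftrightarrow> Q)"

end

theory Submission
  imports Defs
begin

text \<open>
  Every assertion is compared with (c), the pointwise convergence of the generators.

  Write \<open>g\<close> for the generator as a real function on \<open>(0,1]\<close> and \<open>D\<close> for its right-hand derivative.

  For (a), the key is that for \<open>z\<close> in \<open>(0,1]\<close> the inequalities \<open>z \<le> C x y\<close> and \<open>\<phi> x + \<phi> y \<le> \<phi> z\<close> are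
  equivalent (\<open>C_ge_iff\<close>).  A strict inequality between limits holds eventually along the sequences, so
  (c) gives (a) at once.  Conversely, under (a) every
  strict comparison between \<open>g x + g y\<close> and \<open>g z\<close> eventually holds for the \<open>n\<close>-th generator too.
  Because of the normalization at \<open>1/2\<close>, the number \<open>1\<close> separates values of the generators correctly in
  the limit; halving and adding extend this to all positive dyadic numbers (\<open>separating_dyadic\<close>), and
  these are dense.

  For (d), slopes of a convex function bound its one-sided derivatives, so pointwise convergence
  of \<open>g\<close> gives convergence of \<open>D\<close> wherever the limit is continuous.  Since \<open>g x\<close> is minus the integral of
  \<open>D\<close> over \<open>[x,1]\<close> and \<open>D\<close> has only countably many discontinuities, dominated convergence leads back.

  For (b), the Kendall distribution function is \<open>F x = x - g x / D x\<close>.  So (c) and (d) give (b).  Conversely,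
  \<open>1 / (x - F x) = D x / g x\<close> is the logarithmic derivative of \<open>g\<close>; integrated from \<open>1/2\<close> it recovers
  \<open>ln (g x)\<close>, again by dominated convergence.  The domination comes from a locally uniform lower bound
  for \<open>F x - x\<close> (\<open>kendall_uniform_lower\<close>).

  For (e) and (f), the right-hand derivative of \<open>C\<close> in its first variable is \<open>k x y = D x / D (C x y)\<close>,
  and \<open>0\<close> where \<open>C\<close> vanishes.  For fixed \<open>y\<close> it is, for almost every \<open>x\<close>, the value at \<open>y\<close> of the conditional
  distribution function given \<open>x\<close>.  Under (c) the functions \<open>k\<close> converge for every \<open>y\<close> and almost every \<open>x\<close>
  (\<open>kernels_tendsto_ae\<close>), which yields (e) by dominated convergence and (f) by restricting \<open>y\<close> to the
  rational numbers.  Back to (a): the integral of \<open>\<bar>k\<^sub>n x y - k x y\<bar>\<close> over \<open>x\<close> bounds \<open>\<bar>C\<^sub>n x y - C x y\<bar>\<close> and is a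
  Lipschitz function of \<open>y\<close>, so its convergence in the mean forces pointwise convergence.

  That the law of a copula and a Markov kernel exist at all has to be shown.  Both are built from \<open>k\<close> by
  the quantile transform: if \<open>t\<close> and \<open>u\<close> are independent and uniform, then \<open>t\<close> together with the
  \<open>u\<close>-quantile of \<open>k t\<close> has distribution function \<open>C\<close> (locale \<open>conditional_cdf\<close>).
\<close>

section \<open>Lipschitz functions with right-hand derivatives\<close>

lemma eventually_at_right_between: "(x::real) < b \<Longrightarrow> \<forall>\<^sub>F y in at_right x. x < y \<and> y < b"
  using eventually_at_right_real[of x b] by simp

lemma tendsto_at_right_unit:
  fixes f :: "real \<Rightarrow> real"
  assumes "continuous_on {0..1} f" "0 \<le> x" "x < 1"
  shows "(f \<longlongrightarrow> f x) (at_right x)"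
proof -
  have "(f \<longlongrightarrow> f x) (at x within {0..1})"
    using assms by (simp add: continuous_on_def)
  then have "(f \<longlongrightarrow> f x) (at x within {x<..<1})"
    by (rule tendsto_within_subset) (use assms in auto)
  moreover have "at x within {x<..<1} = at_right x"
    by (rule at_within_nhd[of x "{..<1}"]) (use assms in auto)
  ultimately show ?thesis by simp
qed

text \<open>
  Dominated convergence for gauge integrals, in the form used below: the values of the integrals are named
  rather than the integrals themselves, the bound is only required eventually, and a negligible set is
  exempt from both the bound and the convergence.
\<close>

lemma dominated_convergence_ae_interval:
  fixes f :: "nat \<Rightarrow> real \<Rightarrow> real"
  assumes f: "\<forall>\<^sub>F n in sequentially. (f n has_integral I n) {a..b} \<and> (\<forall>x\<in>{a..b} - N. \<bar>f n x\<bar> \<le> B)"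
    and N: "negligible N"
    and lim: "\<And>x. x \<in> {a..b} - N \<Longrightarrow> (\<lambda>n. f n x) \<longlonglongrightarrow> h x"
  shows "h integrable_on {a..b}" "I \<longlonglongrightarrow> integral {a..b} h"
proof -
  obtain m where m: "\<And>n. n \<ge> m \<Longrightarrow> (f n has_integral I n) {a..b}"
    "\<And>n x. n \<ge> m \<Longrightarrow> x \<in> {a..b} - N \<Longrightarrow> \<bar>f n x\<bar> \<le> B"
    using f unfolding eventually_sequentially by blast
  let ?f = "\<lambda>n x. if x \<in> N then 0 else f (n + m) x"
  let ?h = "\<lambda>x. if x \<in> N then 0 else h x"
  have hi: "(?f n has_integral I (n + m)) {a..b}" for n
    by (rule has_integral_spike[OF N _ m(1)]) auto
  have "norm (?f n x) \<le> \<bar>B\<bar>" if "x \<in> {a..b}" for n x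
    using m(2)[of "n + m" x] that by fastforce
  moreover have "(\<lambda>n. ?f n x) \<longlonglongrightarrow> ?h x" if "x \<in> {a..b}" for x
    using lim[of x] that LIMSEQ_ignore_initial_segment[of "\<lambda>n. f n x" "h x" m] by auto
  ultimately have *: "?h integrable_on {a..b}"
    "(\<lambda>n. integral {a..b} (?f n)) \<longlonglongrightarrow> integral {a..b} ?h"
    using dominated_convergence[of ?f "{a..b}" "\<lambda>_. \<bar>B\<bar>" ?h] hi by (blast intro: has_integral_integrable)+
  show "h integrable_on {a..b}"
    by (rule integrable_spike[OF *(1) N]) auto
  have "integral {a..b} ?h = integral {a..b} h"
    by (rule integral_spike[OF N]) auto
  moreover have "integral {a..b} (?f n) = I (n + m)" for n
    using hi by (rule integral_unique)
  ultimately show "I \<longlonglongrightarrow> integral {a..b} h"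
    using *(2) by (simp add: LIMSEQ_offset)
qed

text \<open>
  The fundamental theorem of calculus for a Lipschitz function that is only differentiable from the right,
  and only off a negligible set.  The difference quotients with step \<open>1/(n+1)\<close> are bounded by the Lipschitz
  constant and converge to \<open>f'\<close>; their integrals telescope to two short averages of the continuous function
  \<open>f\<close>, one at \<open>b\<close> and one at \<open>a\<close>.
\<close>

lemma has_integral_right_derivative:
  fixes f f' :: "real \<Rightarrow> real"
  assumes "a \<le> b" and lip: "L-lipschitz_on {a..b} f" and N: "negligible N"
    and der: "\<And>x. x \<in> {a..<b} - N \<Longrightarrow> (f has_real_derivative f' x) (at_right x)"
  shows "(f' has_integral f b - f a) {a..b}"
proof -
  \<comment> \<open>constant continuation, so that the difference quotients make sense up to the endpoint\<close>
  define F where "F x = f (min (max x a) b)" for x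
  have L: "0 \<le> L" using lip by (rule lipschitz_on_nonneg)
  have lipF: "\<bar>F x - F y\<bar> \<le> L * \<bar>x - y\<bar>" for x y
  proof -
    have "\<bar>F x - F y\<bar> \<le> L * \<bar>min (max x a) b - min (max y a) b\<bar>"
      using lipschitz_onD[OF lip, of "min (max x a) b" "min (max y a) b"] \<open>a \<le> b\<close>
      unfolding F_def by (auto simp: dist_real_def)
    also have "\<dots> \<le> L * \<bar>x - y\<bar>"
      using L by (intro mult_left_mono) auto
    finally show ?thesis .
  qed
  have "L-lipschitz_on UNIV F"
    using lipF L by (intro lipschitz_onI) (auto simp: dist_real_def)
  then have contF: "continuous_on S F" for S
    using lipschitz_on_continuous_on continuous_on_subset by blast
  obtain G where G0: "\<And>x. x \<in> {a-2..b+2} \<Longrightarrow> (G has_vector_derivative F x) (at x within {a-2..b+2})"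
    using antiderivative_continuous[OF contF] by metis
  have G: "(G has_real_derivative F x) (at x)" if "a - 2 < x" "x < b + 2" for x
    using G0[of x] that at_within_interior[of x "{a-2..b+2}"]
    by (simp add: has_real_derivative_iff_has_vector_derivative)
  define q where "q n x = (F (x + 1 / Suc n) - F x) * Suc n" for n :: nat and x
  define I where "I n = ((G (b + 1 / Suc n) - G b) - (G (a + 1 / Suc n) - G a)) * Suc n" for n :: nat
  have hi: "(q n has_integral I n) {a..b}" for n
  proof -
    let ?h = "1 / real (Suc n)"
    have h: "0 < ?h" "?h \<le> 1" by auto
    have "((\<lambda>x. F (x + ?h)) has_integral G (b + ?h) - G (a + ?h)) {a..b}"
    proof (rule fundamental_theorem_of_calculus[OF \<open>a \<le> b\<close>])
      fix x assume "x \<in> {a..b}"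
      then have "a \<le> x" "x \<le> b" by auto
      have "(G has_real_derivative F (x + ?h)) (at (x + ?h))"
        using h \<open>a \<le> x\<close> \<open>x \<le> b\<close> by (intro G) linarith+
      then have "((\<lambda>x. G (x + ?h)) has_real_derivative F (x + ?h)) (at x)"
        by (simp add: DERIV_shift)
      then show "((\<lambda>x. G (x + ?h)) has_vector_derivative F (x + ?h)) (at x within {a..b})"
        by (simp add: has_real_derivative_iff_has_vector_derivative has_vector_derivative_at_within)
    qed
    moreover have "(F has_integral G b - G a) {a..b}"
    proof (rule fundamental_theorem_of_calculus[OF \<open>a \<le> b\<close>])
      fix x assume x: "x \<in> {a..b}"
      show "(G has_vector_derivative F x) (at x within {a..b})"
        using G[of x] x
        by (simp add: has_real_derivative_iff_has_vector_derivative has_vector_derivative_at_within)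
    qed
    ultimately have "((\<lambda>x. F (x + ?h) - F x) has_integral
        (G (b + ?h) - G (a + ?h)) - (G b - G a)) {a..b}"
      by (rule has_integral_diff)
    from has_integral_mult_left[OF this, of "Suc n"] show ?thesis
      unfolding q_def[abs_def] I_def by (simp add: algebra_simps)
  qed
  have bnd: "\<bar>q n x\<bar> \<le> L" for n x
  proof -
    have "\<bar>q n x\<bar> = \<bar>F (x + 1 / Suc n) - F x\<bar> * Suc n"
      unfolding q_def by (simp only: abs_mult abs_of_nat)
    also have "\<dots> \<le> (L * \<bar>(x + 1 / Suc n) - x\<bar>) * Suc n"
      by (intro mult_right_mono lipF) simp
    finally show ?thesis by simp
  qed
  have seq: "filterlim (\<lambda>n. x + 1 / real (Suc n)) (at_right x) sequentially" for x
  proof (rule tendsto_imp_filterlim_at_right)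
    show "(\<lambda>n. x + 1 / real (Suc n)) \<longlonglongrightarrow> x"
      using tendsto_add[OF tendsto_const LIMSEQ_inverse_real_of_nat, of x]
      by (simp add: inverse_eq_divide)
  qed auto
  have diffq: "(\<lambda>n. (p (x + 1 / Suc n) - p x) * Suc n) \<longlonglongrightarrow> d"
    if "(p has_real_derivative d) (at_right x)" for p :: "real \<Rightarrow> real" and x d
    using filterlim_compose[OF that[unfolded has_field_derivative_iff] seq[of x]] by simp
  have lim: "(\<lambda>n. q n x) \<longlonglongrightarrow> f' x" if x: "x \<in> {a..b} - (insert b N)" for x
  proof -
    have "(F has_real_derivative f' x) (at_right x)"
    proof -
      have "((\<lambda>y. (f y - f x) / (y - x)) \<longlongrightarrow> f' x) (at_right x)"
        using der[of x] x by (auto simp: has_field_derivative_iff)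
      moreover have "\<forall>\<^sub>F y in at_right x. x < y \<and> y < b"
        using x by (intro eventually_at_right_between) auto
      then have "\<forall>\<^sub>F y in at_right x. (f y - f x) / (y - x) = (F y - F x) / (y - x)"
        by eventually_elim (use x in \<open>auto simp: F_def\<close>)
      ultimately show ?thesis
        unfolding has_field_derivative_iff by (rule Lim_transform_eventually)
    qed
    then show ?thesis unfolding q_def by (rule diffq)
  qed
  have *: "f' integrable_on {a..b}" "I \<longlonglongrightarrow> integral {a..b} f'"
    using dominated_convergence_ae_interval[of q I a b "insert b N" L f'] hi bnd lim N by auto
  have "I \<longlonglongrightarrow> F b - F a"
  proof -
    have "(\<lambda>n. (G (b + 1 / Suc n) - G b) * Suc n - (G (a + 1 / Suc n) - G a) * Suc n)
        \<longlonglongrightarrow> F b - F a"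
      using \<open>a \<le> b\<close> by (intro tendsto_diff diffq has_field_derivative_at_within[OF G]) auto
    then show ?thesis unfolding I_def by (simp add: left_diff_distrib)
  qed
  with *(2) have "integral {a..b} f' = f b - f a"
    using LIMSEQ_unique \<open>a \<le> b\<close> unfolding F_def by fastforce
  with *(1) show ?thesis by (simp add: has_integral_integral)
qed

section \<open>Generators and their right-hand derivatives\<close>

definition gen_fun :: "(real \<Rightarrow> ennreal) \<Rightarrow> real \<Rightarrow> real" where
  "gen_fun \<phi> x = enn2real (\<phi> x)"

lemma slope_swap: "(a - b) / (c - d) = (b - a) / (d - c)" for a b c d :: real
  by (metis minus_diff_eq minus_divide_divide)

locale archimedean_generator =
  fixes \<phi> :: "real \<Rightarrow> ennreal"
  assumes gen: "generator \<phi>"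
begin

abbreviation g :: "real \<Rightarrow> real" where "g \<equiv> gen_fun \<phi>"
abbreviation D :: "real \<Rightarrow> real" where "D \<equiv> right_deriv \<phi>"
abbreviation C :: "real \<Rightarrow> real \<Rightarrow> real" where "C \<equiv> arch_copula \<phi>"

lemma phi_less: "0 \<le> x \<Longrightarrow> x < y \<Longrightarrow> y \<le> 1 \<Longrightarrow> \<phi> y < \<phi> x"
  using gen monotone_onD[of "{0..1}" "(<)" "\<lambda>x y. y < x" \<phi> x y] unfolding generator_def by auto

lemma phi_less_iff: "x \<in> {0..1} \<Longrightarrow> y \<in> {0..1} \<Longrightarrow> \<phi> y < \<phi> x \<longleftrightarrow> x < y"
  by (metis atLeastAtMost_iff less_asym linorder_neqE_linordered_idom order_less_irrefl phi_less)

lemma phi_le_iff: "x \<in> {0..1} \<Longrightarrow> y \<in> {0..1} \<Longrightarrow> \<phi> y \<le> \<phi> x \<longleftrightarrow> x \<le> y"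
  by (metis linorder_not_le phi_less_iff)

lemma phi_inj: "inj_on \<phi> {0..1}"
  by (metis inj_onI linorder_neqE_linordered_idom order_less_irrefl phi_less_iff)

lemma phi_1 [simp]: "\<phi> 1 = 0"
  using gen unfolding generator_def by auto

lemma phi_eq: "0 < x \<Longrightarrow> x \<le> 1 \<Longrightarrow> \<phi> x = ennreal (g x)"
  using phi_less[of 0 x] unfolding gen_fun_def
  by (intro ennreal_enn2real[symmetric]) (auto intro: order_less_le_trans)

lemma g_nonneg [simp]: "0 \<le> g x"
  by (simp add: gen_fun_def)

lemma g_1 [simp]: "g 1 = 0"
  by (simp add: gen_fun_def)

lemma g_half [simp]: "g (1/2) = 1"
  using gen by (simp add: gen_fun_def generator_def)

lemma g_less: "0 < x \<Longrightarrow> x < y \<Longrightarrow> y \<le> 1 \<Longrightarrow> g y < g x"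
  using phi_less[of x y] phi_eq[of x] phi_eq[of y] by (simp add: ennreal_less_iff)

lemma g_le: "0 < x \<Longrightarrow> x \<le> y \<Longrightarrow> y \<le> 1 \<Longrightarrow> g y \<le> g x"
  using g_less[of x y] by (cases "x = y") auto

lemma g_less_iff: "x \<in> {0<..1} \<Longrightarrow> y \<in> {0<..1} \<Longrightarrow> g y < g x \<longleftrightarrow> x < y"
  by (metis g_le g_less greaterThanAtMost_iff linorder_not_le)

lemma g_pos: "0 < x \<Longrightarrow> x < 1 \<Longrightarrow> 0 < g x"
  using g_less[of x 1] by simp

lemma g_convex: "convex_on {0<..1} g"
proof (rule convex_onI)
  fix t x y :: real assume t: "0 < t" "t < 1" and x: "x \<in> {0<..1}" and y: "y \<in> {0<..1}"
  let ?z = "(1 - t) * x + t * y"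
  have z: "?z \<in> {0<..1}"
    using convexD_alt[of "{0<..1::real}" x y t] t x y by simp
  have "\<phi> ?z \<le> ennreal (1 - t) * \<phi> x + ennreal t * \<phi> y"
    using gen t x y unfolding generator_def by auto
  then have "ennreal (g ?z) \<le> ennreal ((1 - t) * g x + t * g y)"
    using phi_eq[of x] phi_eq[of y] phi_eq[of ?z] x y z t
    by (simp add: ennreal_mult[symmetric] ennreal_plus[symmetric] del: ennreal_plus)
  then show "g ((1 - t) *\<^sub>R x + t *\<^sub>R y) \<le> (1 - t) * g x + t * g y"
    using t by (subst (asm) ennreal_le_iff) auto
qed simp

lemma slope_left_mono:
  "0 < x \<Longrightarrow> x < y \<Longrightarrow> y \<le> z \<Longrightarrow> z \<le> 1 \<Longrightarrow> (g y - g x) / (y - x) \<le> (g z - g x) / (z - x)"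
  using convex_on_slope_le(1)[OF g_convex, of x z y]
  by (cases "y = z") (simp_all add: slope_swap[of "g x"])

lemma slope_right_mono:
  "0 < x \<Longrightarrow> x \<le> y \<Longrightarrow> y < z \<Longrightarrow> z \<le> 1 \<Longrightarrow> (g z - g x) / (z - x) \<le> (g z - g y) / (z - y)"
  using convex_on_slope_le(2)[OF g_convex, of x z y]
  by (cases "x = y") (simp_all add: slope_swap[of _ "g z"])

lemma slope_mono:
  assumes "0 < x" "x < y" "y \<le> z" "z < w" "w \<le> 1"
  shows "(g y - g x) / (y - x) \<le> (g w - g z) / (w - z)"
  using slope_left_mono[of x y w] slope_right_mono[of x z w] assms by linarith

text \<open>
  Slopes on \<open>[a,1]\<close> lie between the slope over \<open>[a/2,a]\<close> and \<open>0\<close>.  In particular \<open>g\<close> is continuous at \<open>1\<close>,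
  which convexity alone does not give.
\<close>

lemma g_lipschitz:
  assumes "0 < a"
  obtains L where "L-lipschitz_on {a..1} g"
proof (cases "a \<le> 1")
  case True
  define L where "L = (g (a/2) - g a) / (a/2)"
  have L: "0 \<le> L"
    using g_le[of "a/2" a] assms True by (simp add: L_def)
  have *: "\<bar>g x - g y\<bar> \<le> L * \<bar>x - y\<bar>" if "a \<le> x" "x < y" "y \<le> 1" for x y
  proof -
    have "- L \<le> (g y - g x) / (y - x)"
      using slope_mono[of "a/2" a x y] that assms by (simp add: L_def field_simps)
    then have "- L * (y - x) \<le> g y - g x"
      using that by (simp add: le_divide_eq)
    moreover have "g y \<le> g x"
      using g_le[of x y] that assms by simp
    ultimately show ?thesis
      using that by (simp add: abs_if)
  qed
  have "L-lipschitz_on {a..1} g"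
  proof (rule lipschitz_onI)
    fix x y assume "x \<in> {a..1}" "y \<in> {a..1}"
    then show "dist (g x) (g y) \<le> L * dist x y"
      using *[of x y] *[of y x] L
      by (cases x y rule: linorder_cases) (auto simp: dist_real_def abs_minus_commute)
  qed (rule L)
  then show ?thesis by (rule that)
next
  case False
  then show ?thesis using that[of 0] by (simp add: lipschitz_on_def)
qed

lemma g_cont: "continuous_on {0<..1} g"
proof -
  have "continuous (at x within {0<..1}) g" if x: "x \<in> {0<..1}" for x
  proof -
    obtain L where "L-lipschitz_on {x/2..1} g" using g_lipschitz[of "x/2"] x by auto
    then have "continuous_on {x/2..1} g" by (rule lipschitz_on_continuous_on)
    then have "continuous (at x within {x/2..1}) g"
      using x by (simp add: continuous_on_eq_continuous_within)
    moreover have "at x within {x/2..1} = at x within {0<..1}"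
      by (rule at_within_nhd[of x "{x/2<..}"]) (use x in auto)
    ultimately show ?thesis by simp
  qed
  then show ?thesis by (simp add: continuous_on_eq_continuous_within)
qed

lemma g_isCont: "0 < x \<Longrightarrow> x < 1 \<Longrightarrow> isCont g x"
  using continuous_on_interior[OF g_cont, of x] by simp

text \<open>
  The generator takes every real value below \<open>\<phi> 0\<close>.  For \<open>\<phi> 0 = \<infinity>\<close> this is every nonnegative real number;
  the right-continuity at \<open>0\<close> enters here.
\<close>

lemma g_surj:
  assumes "0 \<le> v" "ennreal v < \<phi> 0"
  obtains x where "x \<in> {0<..1}" "g x = v"
proof -
  have "(\<phi> \<longlongrightarrow> \<phi> 0) (at_right 0)"
    using gen unfolding generator_def by simp
  then have "\<forall>\<^sub>F x in at_right 0. ennreal v < \<phi> x"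
    using assms(2) by (rule order_tendstoD)
  moreover have "\<forall>\<^sub>F x in at_right (0::real). 0 < x \<and> x < 1"
    by (intro eventually_at_right_between) auto
  ultimately have "\<forall>\<^sub>F x in at_right (0::real). ennreal v < \<phi> x \<and> x < 1 \<and> 0 < x"
    by eventually_elim auto
  then obtain a where a: "ennreal v < \<phi> a" "a < 1" "0 < a"
    using eventually_happens' trivial_limit_at_right_real by blast
  then have "v \<le> g a"
    using phi_eq[of a] assms(1) by (simp add: ennreal_less_iff)
  moreover have "continuous_on {a..1} g"
    using g_cont a by (auto intro: continuous_on_subset)
  ultimately obtain x where "a \<le> x" "x \<le> 1" "g x = v"
    using IVT2'[of g 1 v a] a assms(1) by auto
  then show ?thesis
    using a that[of x] by auto
qed

lemma g_between:
  assumes "0 \<le> u" "u < v" "ennreal u < \<phi> 0"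
  obtains x where "x \<in> {0<..1}" "u < g x" "g x < v"
proof -
  have "ennreal u < min (ennreal v) (\<phi> 0)"
    using assms by (simp add: ennreal_less_iff)
  then obtain w where w: "ennreal u < w" "w < min (ennreal v) (\<phi> 0)"
    using dense by blast
  then have "w = ennreal (enn2real w)"
    by (metis ennreal_enn2real min.strict_boundedE order_less_le_trans top_greatest)
  then obtain r where r: "0 \<le> r" "w = ennreal r"
    using enn2real_nonneg by blast
  then obtain x where "x \<in> {0<..1}" "g x = r"
    using g_surj[of r] w by auto
  then show ?thesis
    using that[of x] w r assms by (simp add: ennreal_less_iff)
qed

lemma g_less_phi_0: "x \<in> {0<..1} \<Longrightarrow> ennreal (g x) < \<phi> 0"
  using phi_less[of 0 x] phi_eq[of x] by simp

text \<open>
  The difference quotients decrease as the right end point moves towards \<open>x\<close>, and they are bounded below by a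
  slope on the left of \<open>x\<close>.  So they converge, and the limit in the definition of the right-hand derivative exists.
\<close>

lemma D_has_derivative:
  assumes "0 < x" "x < 1"
  shows "(g has_real_derivative D x) (at_right x)"
proof -
  let ?s = "\<lambda>y. (g y - g x) / (y - x)"
  have "(?s \<longlongrightarrow> Inf (?s ` ({x<..} \<inter> {..1}))) (at x within ({x<..} \<inter> {..1}))"
  proof (rule Lim_right_bound[where K = "(g x - g (x/2)) / (x - x/2)"])
    fix a b assume "a \<in> {..1}" "b \<in> {..1}" "x < a" "a \<le> b"
    then show "?s a \<le> ?s b" using slope_left_mono[of x a b] assms by auto
  next
    fix a assume "a \<in> {..1}" "x < a"
    then show "(g x - g (x/2)) / (x - x/2) \<le> ?s a"
      using slope_mono[of "x/2" x x a] assms by auto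
  qed
  moreover have "at x within ({x<..} \<inter> {..1}) = at_right x"
    by (rule at_within_nhd[of x "{..<1}"]) (use assms in auto)
  ultimately have lim: "(?s \<longlongrightarrow> Inf (?s ` ({x<..} \<inter> {..1}))) (at_right x)"
    by simp
  then have "D x = Inf (?s ` ({x<..} \<inter> {..1}))"
    unfolding right_deriv_def gen_fun_def by (intro tendsto_Lim) simp_all
  with lim show ?thesis
    by (simp add: has_field_derivative_iff)
qed

lemma D_slope_tendsto:
  "0 < x \<Longrightarrow> x < 1 \<Longrightarrow> ((\<lambda>y. (g y - g x) / (y - x)) \<longlongrightarrow> D x) (at_right x)"
  using D_has_derivative by (simp add: has_field_derivative_iff)

lemma D_le_slope:
  assumes "0 < x" "x < y" "y \<le> 1"
  shows "D x \<le> (g y - g x) / (y - x)"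
proof (rule tendsto_upperbound[OF D_slope_tendsto])
  have "\<forall>\<^sub>F z in at_right x. x < z \<and> z < y"
    using assms by (intro eventually_at_right_between) auto
  then show "\<forall>\<^sub>F z in at_right x. (g z - g x) / (z - x) \<le> (g y - g x) / (y - x)"
    by eventually_elim (use assms slope_left_mono in auto)
qed (use assms in auto)

lemma slope_le_D:
  assumes "0 < x" "x < y" "y < 1"
  shows "(g y - g x) / (y - x) \<le> D y"
proof (rule tendsto_lowerbound[OF D_slope_tendsto])
  have "\<forall>\<^sub>F z in at_right y. y < z \<and> z < 1"
    using assms by (intro eventually_at_right_between) auto
  then show "\<forall>\<^sub>F z in at_right y. (g y - g x) / (y - x) \<le> (g z - g y) / (z - y)"
    by eventually_elim (use assms slope_mono in auto)
qed (use assms in auto)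

lemma D_mono: "0 < x \<Longrightarrow> x \<le> y \<Longrightarrow> y < 1 \<Longrightarrow> D x \<le> D y"
  using D_le_slope[of x y] slope_le_D[of x y] by (cases "x = y") auto

lemma D_neg:
  assumes "0 < x" "x < 1"
  shows "D x < 0"
proof -
  have "D x \<le> - g x / (1 - x)" using D_le_slope[of x 1] assms by simp
  also have "\<dots> < 0" using g_pos[of x] assms by simp
  finally show ?thesis .
qed

text \<open>
  A slope from \<open>x\<close> to a nearby \<open>z\<close> is close to \<open>D x\<close>; by continuity of \<open>g\<close> so is the slope from \<open>y\<close> to \<open>z\<close> for \<open>y\<close>
  close to \<open>x\<close>, and it bounds \<open>D y\<close> from above.
\<close>

lemma D_right_cont:
  assumes x: "0 < x" "x < 1"
  shows "(D \<longlongrightarrow> D x) (at_right x)"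
proof (rule order_tendstoI)
  fix a assume a: "a < D x"
  have "\<forall>\<^sub>F y in at_right x. x < y \<and> y < 1"
    using assms by (intro eventually_at_right_between) auto
  then show "\<forall>\<^sub>F y in at_right x. a < D y"
    by eventually_elim (rule less_le_trans[OF a D_mono], use x in auto)
next
  fix a assume a: "D x < a"
  have "\<forall>\<^sub>F z in at_right x. (g z - g x) / (z - x) < a"
    using order_tendstoD(2)[OF D_slope_tendsto[OF x] a] .
  moreover have "\<forall>\<^sub>F z in at_right x. x < z \<and> z < 1"
    using assms by (intro eventually_at_right_between) auto
  ultimately have "\<forall>\<^sub>F z in at_right x. (g z - g x) / (z - x) < a \<and> x < z \<and> z < 1"
    by eventually_elim auto
  then obtain z where z: "(g z - g x) / (z - x) < a" "x < z" "z < 1"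
    using eventually_happens' trivial_limit_at_right_real by blast
  have "((\<lambda>y. (g z - g y) / (z - y)) \<longlongrightarrow> (g z - g x) / (z - x)) (at_right x)"
    using g_isCont[OF x] z
    by (intro tendsto_intros) (auto simp: isCont_def intro: tendsto_within_subset)
  then have "\<forall>\<^sub>F y in at_right x. (g z - g y) / (z - y) < a"
    using z(1) by (rule order_tendstoD)
  moreover have "\<forall>\<^sub>F y in at_right x. x < y \<and> y < z"
    using z by (intro eventually_at_right_between) auto
  ultimately show "\<forall>\<^sub>F y in at_right x. D y < a"
    by eventually_elim (rule le_less_trans[OF D_le_slope[of _ z]], use x z in auto)
qed

lemma discont_D_countable: "countable ({0<..<1} - cont_right_deriv \<phi>)"
proof -
  have "mono_on {0<..<1} D" by (auto intro!: mono_onI D_mono)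
  then have "countable {x \<in> {0<..<1}. \<not> isCont D x}"
    by (rule mono_on_ctble_discont_open[rotated]) auto
  moreover have "{0<..<1} - cont_right_deriv \<phi> = {x \<in> {0<..<1}. \<not> isCont D x}"
    by (auto simp: cont_right_deriv_def)
  ultimately show ?thesis by simp
qed

lemma cont_D_dense:
  assumes "0 \<le> u" "u < v" "v \<le> 1"
  obtains x where "x \<in> cont_right_deriv \<phi>" "u < x" "x < v"
proof -
  have "uncountable {u<..<v}" using assms by (simp add: uncountable_open_interval)
  moreover have "{u<..<v} \<subseteq> {0<..<1}" using assms by auto
  ultimately have "\<not> {u<..<v} \<subseteq> {0<..<1} - cont_right_deriv \<phi>"
    using discont_D_countable countable_subset by blast
  with \<open>{u<..<v} \<subseteq> {0<..<1}\<close> show ?thesis using that by auto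
qed

lemma D_has_integral:
  assumes "0 < a" "a \<le> b" "b \<le> 1"
  shows "(D has_integral g b - g a) {a..b}"
proof -
  obtain L where "L-lipschitz_on {a..1} g" using g_lipschitz assms(1) by blast
  then have "L-lipschitz_on {a..b} g" using assms by (auto intro: lipschitz_on_subset)
  then show ?thesis
    using assms by (intro has_integral_right_derivative[where N = "{}"] D_has_derivative) auto
qed

end

section \<open>The copula of a generator and its conditional distribution functions\<close>

text \<open>
  For \<open>x\<close> in \<open>(0,1)\<close> this is the right-hand derivative in \<open>x\<close> of the copula, except at the one point where the
  copula may leave \<open>0\<close>.  The value \<open>1\<close> elsewhere makes \<open>arch_kernel \<phi> x\<close> monotone with value \<open>1\<close> at \<open>1\<close> for every \<open>x\<close>.
\<close>

definition arch_kernel :: "(real \<Rightarrow> ennreal) \<Rightarrow> real \<Rightarrow> real \<Rightarrow> real" where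
  "arch_kernel \<phi> x y =
     (if 0 < x \<and> x < 1 then
        if 0 < arch_copula \<phi> x y then right_deriv \<phi> x / right_deriv \<phi> (arch_copula \<phi> x y) else 0
      else 1)"

context archimedean_generator
begin

abbreviation k :: "real \<Rightarrow> real \<Rightarrow> real" where "k \<equiv> arch_kernel \<phi>"

lemma C_cases:
  assumes "x \<in> {0..1}" "y \<in> {0..1}"
  obtains "C x y \<in> {0<..1}" "\<phi> (C x y) = \<phi> x + \<phi> y"
  | "C x y = 0" "\<phi> 0 \<le> \<phi> x + \<phi> y"
proof (cases "\<phi> x + \<phi> y < \<phi> 0")
  case True
  then have "\<phi> x + \<phi> y < \<top>"
    by (rule order_less_le_trans) simp
  then have fin: "\<phi> x + \<phi> y = ennreal (enn2real (\<phi> x + \<phi> y))"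
    by (rule ennreal_enn2real[symmetric])
  obtain c where c: "c \<in> {0<..1}" "g c = enn2real (\<phi> x + \<phi> y)"
    by (rule g_surj[of "enn2real (\<phi> x + \<phi> y)"]) (use True fin in auto)
  then have "\<phi> c = \<phi> x + \<phi> y"
    using phi_eq[of c] fin by simp
  moreover from this have "C x y = c"
    using the_inv_into_f_f[OF phi_inj, of c] c True
    by (simp add: arch_copula_def pseudo_inverse_def)
  ultimately show ?thesis using that(1) c by simp
next
  case False
  then show ?thesis
    using that(2) by (simp add: arch_copula_def pseudo_inverse_def)
qed

text \<open>
  This equivalence replaces the pseudo-inverse in everything that follows.  The value \<open>z = 0\<close> has to be excluded:
  \<open>0 \<le> C x y\<close> always holds, while \<open>\<phi> x + \<phi> y\<close> may exceed \<open>\<phi> 0\<close>.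
\<close>

lemma C_ge_iff:
  assumes "x \<in> {0..1}" "y \<in> {0..1}" "z \<in> {0<..1}"
  shows "z \<le> C x y \<longleftrightarrow> \<phi> x + \<phi> y \<le> \<phi> z"
  using assms(1,2)
proof (cases rule: C_cases)
  case 1
  then show ?thesis using phi_le_iff[of z "C x y"] assms(3) by auto
next
  case 2
  have "\<phi> z < \<phi> 0" using phi_less[of 0 z] assms(3) by simp
  then show ?thesis using 2 assms(3) by (auto simp: not_le)
qed

lemma C_range: "x \<in> {0..1} \<Longrightarrow> y \<in> {0..1} \<Longrightarrow> C x y \<in> {0..1}"
  by (erule (1) C_cases) auto

lemma C_comm: "C x y = C y x"
  by (simp add: arch_copula_def add.commute)

lemma le_by_test_points:
  assumes "b \<in> {0..1}" "a \<in> {0..1}" "\<And>z. z \<in> {0<..1} \<Longrightarrow> z \<le> a \<Longrightarrow> z \<le> b"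
  shows "a \<le> (b::real)"
  using assms(3)[of a] assms(1,2) by (cases "a = 0") auto

lemma C_1_right [simp]: "x \<in> {0..1} \<Longrightarrow> C x 1 = x"
proof (rule antisym)
  assume x: "x \<in> {0..1}"
  have *: "z \<le> C x 1 \<longleftrightarrow> z \<le> x" if "z \<in> {0<..1}" for z
    using C_ge_iff[of x 1 z] phi_le_iff[of z x] x that by simp
  have 1: "C x 1 \<in> {0..1}" using x C_range[of x 1] by simp
  show "C x 1 \<le> x" by (rule le_by_test_points[OF x 1]) (simp add: *)
  show "x \<le> C x 1" by (rule le_by_test_points[OF 1 x]) (simp add: *)
qed

lemma C_1_left [simp]: "x \<in> {0..1} \<Longrightarrow> C 1 x = x"
  using C_1_right[of x] by (simp add: C_comm)

lemma C_mono:
  assumes "x \<in> {0..1}" "y \<in> {0..1}" "x' \<in> {0..1}" "y' \<in> {0..1}" "x \<le> x'" "y \<le> y'"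
  shows "C x y \<le> C x' y'"
proof (rule le_by_test_points)
  have "\<phi> x' + \<phi> y' \<le> \<phi> x + \<phi> y"
    using assms phi_le_iff by (intro add_mono) auto
  then show "z \<in> {0<..1} \<Longrightarrow> z \<le> C x y \<Longrightarrow> z \<le> C x' y'" for z
    using C_ge_iff[of x y z] C_ge_iff[of x' y' z] assms by auto
qed (use C_range assms in auto)

lemma C_le_left: "x \<in> {0..1} \<Longrightarrow> y \<in> {0..1} \<Longrightarrow> C x y \<le> x"
  using C_mono[of x y x 1] by auto

lemma C_le_right: "x \<in> {0..1} \<Longrightarrow> y \<in> {0..1} \<Longrightarrow> C x y \<le> y"
  using C_le_left[of y x] by (simp add: C_comm)

lemma C_0_left [simp]: "y \<in> {0..1} \<Longrightarrow> C 0 y = 0"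
  using C_le_left[of 0 y] C_range[of 0 y] by auto

lemma C_0_right [simp]: "x \<in> {0..1} \<Longrightarrow> C x 0 = 0"
  using C_0_left[of x] by (simp add: C_comm)

lemma g_C:
  assumes "x \<in> {0..1}" "y \<in> {0..1}" "0 < C x y"
  shows "g (C x y) = g x + g y" "0 < x" "0 < y" "C x y \<le> 1"
proof -
  show pos: "0 < x" "0 < y" "C x y \<le> 1"
    using C_le_left[of x y] C_le_right[of x y] C_range[of x y] assms by auto
  from assms(1,2) have "\<phi> (C x y) = \<phi> x + \<phi> y"
    by (rule C_cases) (use assms(3) in auto)
  then have "ennreal (g (C x y)) = ennreal (g x + g y)"
    using phi_eq[of x] phi_eq[of y] phi_eq[of "C x y"] pos assms by simp
  then show "g (C x y) = g x + g y"
    by (subst (asm) ennreal_inj) auto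
qed

lemma C_ge_iff_g:
  assumes "x \<in> {0<..1}" "y \<in> {0<..1}" "z \<in> {0<..1}"
  shows "z \<le> C x y \<longleftrightarrow> g x + g y \<le> g z"
proof -
  have "z \<le> C x y \<longleftrightarrow> ennreal (g x + g y) \<le> ennreal (g z)"
    using C_ge_iff[of x y z] phi_eq[of x] phi_eq[of y] phi_eq[of z] assms by simp
  then show ?thesis by (subst (asm) ennreal_le_iff) auto
qed

text \<open>
  By convexity, the generator drops over an interval of length \<open>x' - x\<close> at the smaller number \<open>C x y\<close> by at least
  as much as over \<open>[x, x']\<close>; so \<open>C\<close> cannot grow by more than \<open>x' - x\<close>.
\<close>

lemma C_lipschitz_le:
  assumes "x \<in> {0..1}" "x' \<in> {0..1}" "y \<in> {0..1}" "x \<le> x'"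
  shows "C x' y \<le> C x y + (x' - x)"
proof (rule ccontr)
  assume "\<not> ?thesis"
  then have less: "C x y < C x' y - (x' - x)" by simp
  define z where "z = C x' y - (x' - x)"
  have "0 \<le> C x y" using C_range assms by auto
  then have z: "0 < z" "z \<le> x" "x < x'" "0 < C x' y"
    using less C_le_left[of x' y] assms unfolding z_def by (auto simp: less_le)
  have gC: "g (C x' y) = g x' + g y" "0 < y" using g_C[of x' y] z assms by auto
  have "(g (C x' y) - g z) / (C x' y - z) \<le> (g x' - g z) / (x' - z)"
    using slope_left_mono[of z "C x' y" x'] z assms C_le_left[of x' y] by (auto simp: z_def)
  also have "\<dots> \<le> (g x' - g x) / (x' - x)"
    using slope_right_mono[of z x x'] z assms by auto
  finally have "g (C x' y) - g z \<le> g x' - g x"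
    using z by (simp add: z_def divide_le_cancel)
  then have "z \<le> C x y"
    using C_ge_iff_g[of x y z] gC z assms by auto
  with less show False by (simp add: z_def)
qed

lemma C_lipschitz: "y \<in> {0..1} \<Longrightarrow> 1-lipschitz_on {0..1} (\<lambda>x. C x y)"
proof (rule lipschitz_onI)
  fix u v :: real assume y: "y \<in> {0..1}" and uv: "u \<in> {0..1}" "v \<in> {0..1}"
  show "dist (C u y) (C v y) \<le> 1 * dist u v"
    using C_lipschitz_le[of u v y] C_mono[of u y v y] C_lipschitz_le[of v u y] C_mono[of v y u y] uv y
    by (cases "u \<le> v") (auto simp: dist_real_def)
qed simp

lemma C_cont: "y \<in> {0..1} \<Longrightarrow> continuous_on {0..1} (\<lambda>x. C x y)"
  using C_lipschitz lipschitz_on_continuous_on by blast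

lemma C_cont_right: "x \<in> {0..1} \<Longrightarrow> continuous_on {0..1} (\<lambda>y. C x y)"
  using C_cont[of x] by (simp add: C_comm[of x])

lemma C_less_left:
  assumes "x \<in> {0..1}" "x' \<in> {0..1}" "y \<in> {0..1}" "x < x'" "0 < C x y"
  shows "C x y < C x' y"
proof -
  have "0 < C x' y" using C_mono[of x y x' y] assms by auto
  moreover have "g x' < g x" using g_C[of x y] g_less[of x x'] assms by auto
  ultimately show ?thesis
    using g_C[of x y] g_C[of x' y] g_less_iff[of "C x y" "C x' y"] assms by auto
qed

lemma k_pos:
  assumes "x \<in> {0<..<1}" "y \<in> {0..1}" "0 < C x y"
  shows "k x y = D x / D (C x y)" "D (C x y) \<le> D x" "C x y < 1" "D x < 0" "D (C x y) < 0"
proof -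
  show "C x y < 1" using C_le_left[of x y] assms by auto
  then show "k x y = D x / D (C x y)" "D (C x y) \<le> D x" "D x < 0" "D (C x y) < 0"
    using assms C_le_left[of x y] D_mono[of "C x y" x] D_neg by (auto simp: arch_kernel_def)
qed

lemma k_range: "y \<in> {0..1} \<Longrightarrow> k x y \<in> {0..1}"
proof (cases "x \<in> {0<..<1} \<and> 0 < C x y")
  case True
  assume "y \<in> {0..1}"
  then show ?thesis
    using k_pos[of x y] True by (simp add: divide_le_eq_1 zero_le_divide_iff)
qed (auto simp: arch_kernel_def)

lemma k_1: "k x 1 = 1"
  using D_neg[of x] by (auto simp: arch_kernel_def)

lemma k_mono:
  assumes "y \<in> {0..1}" "y' \<in> {0..1}" "y \<le> y'"
  shows "k x y \<le> k x y'"
proof (cases "x \<in> {0<..<1} \<and> 0 < C x y")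
  case True
  then have "0 < C x y'" "C x y \<le> C x y'" using C_mono[of x y x y'] assms by auto
  then show ?thesis
    using k_pos[of x y] k_pos[of x y'] True assms D_mono[of "C x y" "C x y'"]
      divide_left_mono[of "- D (C x y')" "- D (C x y)" "- D x"]
    by (simp add: mult_neg_neg)
next
  case False
  then show ?thesis using k_range[of y' x] assms by (auto simp: arch_kernel_def)
qed

lemma k_measurable:
  assumes y: "y \<in> {0..1}"
  shows "(\<lambda>x. k x y) \<in> borel_measurable unit_borel"
proof -
  define D' where "D' x = (if 0 < x \<and> x < 1 then D x else 0)" for x
  have "mono_on {0<..<1} D" by (auto intro!: mono_onI D_mono)
  then have "D \<in> borel_measurable (restrict_space borel {0<..<1})"
    by (rule borel_measurable_mono_on_fnc)
  then have "(\<lambda>x. D x * indicator {0<..<1} x) \<in> borel_measurable borel"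
    by (simp add: borel_measurable_restrict_space_iff mult.commute)
  moreover have "(\<lambda>x. D x * indicator {0<..<1} x) = D'"
    by (auto simp: D'_def indicator_def)
  ultimately have [measurable]: "D' \<in> borel_measurable borel" by simp
  have [measurable]: "(\<lambda>x. C x y) \<in> borel_measurable unit_borel"
    unfolding unit_borel_def by (rule borel_measurable_continuous_on_restrict[OF C_cont[OF y]])
  have [measurable]: "(\<lambda>x. x) \<in> borel_measurable unit_borel"
    unfolding unit_borel_def by (simp add: measurable_restrict_space1)
  have "(\<lambda>x. if 0 < x \<and> x < 1 then D' x / D' (C x y) else 1) \<in> borel_measurable unit_borel"
    by measurable
  moreover have "k x y = (if 0 < x \<and> x < 1 then D' x / D' (C x y) else 1)" for x
    using C_le_left[of x y] y by (auto simp: arch_kernel_def D'_def)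
  ultimately show ?thesis by simp
qed

text \<open>
  Differentiate \<open>g (C t y) = g t + g y\<close>.  As \<open>C\<close> is strictly increasing in \<open>t\<close> where it is positive, right-hand
  difference quotients of \<open>g\<close> at \<open>C x y\<close> appear.
\<close>

lemma C_right_derivative:
  assumes x: "x \<in> {0<..<1}" and y: "y \<in> {0..1}" and pos: "0 < C x y"
  shows "((\<lambda>t. C t y) has_real_derivative k x y) (at_right x)"
proof -
  let ?c = "\<lambda>t. C t y"
  have c: "0 < C x y" "C x y < 1" using pos C_le_left[of x y] x y by auto
  have ev: "\<forall>\<^sub>F t in at_right x. x < t \<and> t < 1"
    using x by (intro eventually_at_right_between) auto
  have lim: "(?c \<longlongrightarrow> ?c x) (at_right x)"
    by (rule tendsto_at_right_unit[OF C_cont[OF y]]) (use x in auto)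
  have "filterlim ?c (at_right (?c x)) (at_right x)"
  proof (rule tendsto_imp_filterlim_at_right[OF lim])
    show "\<forall>\<^sub>F t in at_right x. C x y < C t y"
      using ev by eventually_elim (use C_less_left[of x _ y] x y pos in auto)
  qed
  from filterlim_compose[OF D_slope_tendsto[OF c] this]
  have "((\<lambda>t. (g (?c t) - g (?c x)) / (?c t - ?c x)) \<longlongrightarrow> D (?c x)) (at_right x)" .
  with D_slope_tendsto[of x] have
    "((\<lambda>t. ((g t - g x) / (t - x)) / ((g (?c t) - g (?c x)) / (?c t - ?c x)))
      \<longlongrightarrow> D x / D (?c x)) (at_right x)"
    using x D_neg[OF c] by (intro tendsto_divide) auto
  moreover have "\<forall>\<^sub>F t in at_right x.
    ((g t - g x) / (t - x)) / ((g (?c t) - g (?c x)) / (?c t - ?c x)) = (?c t - ?c x) / (t - x)"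
    using ev
  proof eventually_elim
    case (elim t)
    then have "0 < ?c t" using C_mono[of x y t y] x y pos by auto
    then have "g (?c t) - g (?c x) = g t - g x"
      using g_C[of x y] g_C[of t y] x y pos elim by simp
    moreover have "g t < g x" using g_less[of x t] elim x by auto
    ultimately show ?case by simp
  qed
  ultimately have "((\<lambda>t. (?c t - ?c x) / (t - x)) \<longlongrightarrow> D x / D (?c x)) (at_right x)"
    by (rule Lim_transform_eventually)
  then show ?thesis
    using k_pos[of x y] x y pos by (simp add: has_field_derivative_iff)
qed

text \<open>
  There is at most one such point, the largest zero of \<open>C\<close> in its first variable.  Only there the right-hand derivative of \<open>C\<close> can
  differ from \<open>k\<close>.
\<close>

lemma finite_last_zeros:
  "finite {t \<in> {0<..<1}. C t y = 0 \<and> (\<forall>t'\<in>{t<..1}. 0 < C t' y)}" (is "finite ?N")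
proof (cases "?N = {}")
  case False
  then obtain a where a: "a \<in> ?N" by blast
  have "b = a" if "b \<in> ?N" for b
  proof (rule ccontr)
    assume "b \<noteq> a"
    then have "a \<in> {b<..1} \<or> b \<in> {a<..1}" using a that by auto
    then have "0 < C a y \<or> 0 < C b y" using a that by blast
    with a that show False by simp
  qed
  then have "?N \<subseteq> {a}" by blast
  then show ?thesis using finite_subset by blast
qed (simp only: finite.emptyI)

lemma k_has_integral:
  assumes x: "x \<in> {0..1}" and y: "y \<in> {0..1}"
  shows "((\<lambda>t. k t y) has_integral C x y) {0..x}"
proof -
  define N where "N = {t \<in> {0<..<1}. C t y = 0 \<and> (\<forall>t'\<in>{t<..1}. 0 < C t' y)}"
  have "finite N" unfolding N_def by (rule finite_last_zeros)
  then have neg: "negligible (insert 0 N)" by (simp add: negligible_finite)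
  have "((\<lambda>t. k t y) has_integral C x y - C 0 y) {0..x}"
  proof (rule has_integral_right_derivative[OF _ _ neg])
    show "1-lipschitz_on {0..x} (\<lambda>x. C x y)"
      using C_lipschitz[OF y] by (rule lipschitz_on_subset) (use x in auto)
    fix t assume t: "t \<in> {0..<x} - insert 0 N"
    then have t01: "t \<in> {0<..<1}" using x by auto
    show "((\<lambda>t. C t y) has_real_derivative k t y) (at_right t)"
    proof (cases "0 < C t y")
      case False
      then have 0: "C t y = 0" using C_range[of t y] t01 y by auto
      with t t01 obtain t' where t': "t < t'" "t' \<le> 1" "\<not> 0 < C t' y"
        unfolding N_def by auto
      then have t'0: "C t' y = 0" using C_range[of t' y] t01 y by auto
      have "\<forall>\<^sub>F s in at_right t. t < s \<and> s < t'"
        by (rule eventually_at_right_between[OF t'(1)])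
      then have "\<forall>\<^sub>F s in at_right t. 0 = (C s y - C t y) / (s - t)"
      proof eventually_elim
        case (elim s)
        then have "C s y = 0"
          using C_mono[of s y t' y] C_range[of s y] t' t'0 t01 y by auto
        then show ?case using 0 by simp
      qed
      then have "((\<lambda>s. (C s y - C t y) / (s - t)) \<longlongrightarrow> 0) (at_right t)"
        by (rule Lim_transform_eventually[OF tendsto_const])
      then show ?thesis
        using 0 t01 by (simp add: has_field_derivative_iff arch_kernel_def)
    qed (use C_right_derivative t01 y in auto)
  qed (use x in auto)
  then show ?thesis using y by simp
qed

end

section \<open>Measures on the unit interval and the unit square\<close>

lemma space_unit_borel [simp]: "space unit_borel = {0..1}"
  by (simp add: unit_borel_def space_restrict_space)

lemma space_unit_lebesgue [simp]: "space unit_lebesgue = {0..1}"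
  by (simp add: unit_lebesgue_def space_restrict_space)

lemma sets_unit_lebesgue [simp, measurable_cong]: "sets unit_lebesgue = sets unit_borel"
  by (simp add: unit_lebesgue_def unit_borel_def sets_restrict_space)

lemma sets_unit_borel_iff: "A \<in> sets unit_borel \<longleftrightarrow> A \<in> sets borel \<and> A \<subseteq> {0..1}"
  unfolding unit_borel_def by (subst sets_restrict_space_iff) auto

lemma atLeastAtMost_unit_borel [measurable]: "x \<le> 1 \<Longrightarrow> {0..x} \<in> sets unit_borel"
  by (simp add: sets_unit_borel_iff)

lemma unit_borel_inclusion [measurable]: "(\<lambda>x. x) \<in> unit_borel \<rightarrow>\<^sub>M borel"
  unfolding unit_borel_def by (simp add: measurable_restrict_space1)

lemma emeasure_unit_lebesgue: "A \<in> sets borel \<Longrightarrow> A \<subseteq> {0..1} \<Longrightarrow> emeasure unit_lebesgue A = emeasure lborel A"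
  unfolding unit_lebesgue_def by (intro emeasure_restrict_space) auto

interpretation unit: prob_space unit_lebesgue
  by (rule prob_spaceI) (simp add: emeasure_unit_lebesgue)

lemma nn_integral_unit_lebesgue:
  "(\<integral>\<^sup>+x. f x \<partial>unit_lebesgue) = (\<integral>\<^sup>+x. f x * indicator {0..1} x \<partial>lborel)"
  unfolding unit_lebesgue_def by (subst nn_integral_restrict_space) auto

lemma AE_unit_lebesgue: "(AE x in unit_lebesgue. P x) \<longleftrightarrow> (AE x in lborel. x \<in> {0..1} \<longrightarrow> P x)"
  unfolding unit_lebesgue_def by (subst AE_restrict_space_iff) auto

lemma AE_unit_countable:
  assumes "countable N" "\<And>x. x \<in> {0<..<1} - N \<Longrightarrow> P x"
  shows "AE x in unit_lebesgue. P x"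
proof -
  have "AE x in lborel. x \<notin> N \<union> {0, 1}"
    using assms(1) by (intro AE_not_in countable_imp_null_set_lborel) auto
  then show ?thesis
    unfolding AE_unit_lebesgue by eventually_elim (use assms(2) in force)
qed

text \<open>
  Intersections with \<open>[0,1]\<close> are taken so that the rays are closed under intersection and include the empty set
  and the whole interval.
\<close>

definition unit_rays :: "real set set" where
  "unit_rays = (\<lambda>x. {0..1} \<inter> {..x}) ` UNIV"

lemma sets_unit_borel_rays: "sets unit_borel = sigma_sets {0..1} unit_rays"
proof -
  have borel: "sets (borel :: real measure) = sigma_sets UNIV (range atMost)"
    by (simp add: borel_eq_atMost)
  have "sets unit_borel = (\<inter>) {0..1} ` sigma_sets UNIV (range atMost)"
    unfolding unit_borel_def by (subst sets_restrict_space) (simp add: borel)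
  also have "\<dots> = sigma_sets {0..1} ((\<inter>) {0..1} ` range atMost)"
    by (rule sigma_sets_Int) (simp_all add: borel[symmetric])
  finally show ?thesis by (simp add: unit_rays_def image_image)
qed

lemma unit_ray_cases:
  assumes "A \<in> unit_rays"
  obtains "A = {}" | x where "x \<in> {0..1}" "A = {0..x}"
proof -
  from assms obtain x where A: "A = {0..1} \<inter> {..x}" by (auto simp: unit_rays_def)
  show ?thesis
  proof (cases "x < 0")
    case False
    then have "min 1 x \<in> {0..1}" "A = {0..min 1 x}" using A by auto
    then show ?thesis by (rule that(2))
  qed (use A that(1) in auto)
qed

lemma unit_ray_Int: "A \<in> unit_rays \<Longrightarrow> B \<in> unit_rays \<Longrightarrow> A \<inter> B \<in> unit_rays"
proof -
  assume "A \<in> unit_rays" "B \<in> unit_rays"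
  then obtain x y where "A = {0..1} \<inter> {..x}" "B = {0..1} \<inter> {..y}"
    by (auto simp: unit_rays_def)
  then have "A \<inter> B = {0..1} \<inter> {..min x y}" by auto
  then show ?thesis unfolding unit_rays_def by blast
qed

lemma unit_interval_ray: "{0..1} \<in> unit_rays"
  unfolding unit_rays_def by (rule image_eqI[of _ _ 1]) auto

lemma unit_measure_eqI:
  assumes "finite_measure M" and [simp]: "sets M = sets unit_borel" "sets N = sets unit_borel"
    and eq: "\<And>x. x \<in> {0..1} \<Longrightarrow> emeasure M {0..x} = emeasure N {0..x}"
  shows "M = N"
proof (rule measure_eqI_generator_eq[where E = unit_rays and \<Omega> = "{0..1}" and A = "\<lambda>_. {0..1}"])
  interpret finite_measure M by fact
  show "Int_stable unit_rays" by (auto intro!: Int_stableI unit_ray_Int)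
  show "unit_rays \<subseteq> Pow {0..1}" by (auto simp: unit_rays_def)
  show "emeasure M X = emeasure N X" if "X \<in> unit_rays" for X
    using that by (rule unit_ray_cases) (auto simp: eq)
qed (auto simp: sets_unit_borel_rays unit_interval_ray finite_measure.emeasure_finite[OF assms(1)])

lemma unit_square_measure_eqI:
  assumes "finite_measure M" and [simp]: "sets M = sets (unit_borel \<Otimes>\<^sub>M unit_borel)"
    "sets N = sets (unit_borel \<Otimes>\<^sub>M unit_borel)"
    and eq: "\<And>x y. x \<in> {0..1} \<Longrightarrow> y \<in> {0..1} \<Longrightarrow> emeasure M ({0..x} \<times> {0..y}) = emeasure N ({0..x} \<times> {0..y})"
  shows "M = N"
proof -
  interpret finite_measure M by fact
  let ?E = "{a \<times> b |a b. a \<in> unit_rays \<and> b \<in> unit_rays}" and ?\<Omega> = "{0..1::real} \<times> {0..1::real}"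
  have sub: "unit_rays \<subseteq> Pow {0..1}" by (auto simp: unit_rays_def)
  have gen: "sets (unit_borel \<Otimes>\<^sub>M unit_borel) = sigma_sets ?\<Omega> ?E"
  proof -
    have "sets (unit_borel \<Otimes>\<^sub>M unit_borel) = sets (sigma (space unit_borel \<times> space unit_borel) ?E)"
      by (rule sets_pair_eq[where Ca = "{{0..1}}" and Cb = "{{0..1}}"])
        (use sub sets_unit_borel_rays unit_interval_ray in auto)
    also have "\<dots> = sigma_sets ?\<Omega> ?E"
      using sub by (simp, intro sets_measure_of) blast
    finally show ?thesis .
  qed
  show ?thesis
  proof (rule measure_eqI_generator_eq[where E = ?E and \<Omega> = ?\<Omega> and A = "\<lambda>_. ?\<Omega>"])
    show "Int_stable ?E"
    proof (rule Int_stableI)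
      fix A B assume "A \<in> ?E" "B \<in> ?E"
      then obtain a b c d where "A = a \<times> b" "B = c \<times> d" "{a, b, c, d} \<subseteq> unit_rays" by auto
      then show "A \<inter> B \<in> ?E" using unit_ray_Int by (auto simp: Times_Int_Times)
    qed
    show "?E \<subseteq> Pow ?\<Omega>" using sub by blast
    show "emeasure M X = emeasure N X" if X: "X \<in> ?E" for X
    proof -
      obtain a b where X: "X = a \<times> b" "a \<in> unit_rays" "b \<in> unit_rays" using X by auto
      from X(2) show ?thesis
      proof (cases rule: unit_ray_cases)
        case (2 x)
        from X(3) show ?thesis by (cases rule: unit_ray_cases) (use 2 X(1) eq in auto)
      qed (use X in simp)
    qed
    show "range (\<lambda>_. ?\<Omega>) \<subseteq> ?E" using unit_interval_ray by blast
  qed (auto simp: gen emeasure_finite)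
qed

section \<open>Laws and Markov kernels from conditional distribution functions\<close>

text \<open>
  For each \<open>x\<close> the function \<open>k x\<close> is nondecreasing, but it need not be right-continuous, so it is a distribution
  function only up to its values at jumps.  Integrated over \<open>x\<close> this ambiguity disappears, because \<open>C\<close> is continuous in its
  second variable.
\<close>

locale conditional_cdf =
  fixes C k :: "real \<Rightarrow> real \<Rightarrow> real"
  assumes k_range: "\<And>x y. y \<in> {0..1} \<Longrightarrow> k x y \<in> {0..1}"
    and k_1: "\<And>x. k x 1 = 1"
    and k_mono: "\<And>x y y'. y \<in> {0..1} \<Longrightarrow> y' \<in> {0..1} \<Longrightarrow> y \<le> y' \<Longrightarrow> k x y \<le> k x y'"
    and k_measurable: "\<And>y. y \<in> {0..1} \<Longrightarrow> (\<lambda>x. k x y) \<in> borel_measurable unit_borel"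
    and k_has_integral: "\<And>x y. x \<in> {0..1} \<Longrightarrow> y \<in> {0..1} \<Longrightarrow> ((\<lambda>t. k t y) has_integral C x y) {0..x}"
    and C_cont_right: "\<And>x. x \<in> {0..1} \<Longrightarrow> continuous_on {0..1} (C x)"
begin

definition quantile :: "real \<Rightarrow> real \<Rightarrow> real" where
  "quantile t u = Inf {y \<in> {0..1}. u \<le> k t y}"

definition K :: "real \<Rightarrow> real measure" where
  "K t = distr unit_lebesgue unit_borel (quantile t)"

definition law :: "(real \<times> real) measure" where
  "law = distr (unit_lebesgue \<Otimes>\<^sub>M unit_lebesgue) (unit_borel \<Otimes>\<^sub>M unit_borel)
     (\<lambda>(t, u). (t, quantile t u))"

lemma quantile_le: "y \<in> {0..1} \<Longrightarrow> u \<le> k t y \<Longrightarrow> quantile t u \<le> y"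
  unfolding quantile_def by (rule cInf_lower) (auto intro: bdd_belowI[of _ 0])

lemma quantile_less:
  assumes "y \<in> {0..1}" "u \<le> 1" "quantile t u < y"
  shows "u \<le> k t y"
proof -
  have "1 \<in> {y \<in> {0..1}. u \<le> k t y}" using assms(2) k_1 by auto
  then obtain z where "z \<in> {0..1}" "u \<le> k t z" "z < y"
    using cInf_lessD[of "{y \<in> {0..1}. u \<le> k t y}" y] assms(3) unfolding quantile_def by blast
  then show ?thesis using k_mono[of z y t] assms(1) by auto
qed

lemma quantile_range: "u \<le> 1 \<Longrightarrow> quantile t u \<in> {0..1}"
proof -
  assume "u \<le> 1"
  then have "1 \<in> {y \<in> {0..1}. u \<le> k t y}" using k_1 by auto
  then have "0 \<le> quantile t u" unfolding quantile_def by (intro cInf_greatest) auto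
  then show ?thesis using quantile_le[of 1 u t] k_1 \<open>u \<le> 1\<close> by auto
qed

text \<open>
  By monotonicity a rational \<open>q\<close> suffices to witness that the quantile is below \<open>y\<close>.  The value \<open>1\<close> serves as witness for
  \<open>y > 1\<close>.
\<close>

lemma quantile_measurable [measurable]:
  "(\<lambda>(t, u). quantile t u) \<in> unit_borel \<Otimes>\<^sub>M unit_borel \<rightarrow>\<^sub>M unit_borel"
proof -
  have "(\<lambda>(t, u). quantile t u) \<in> borel_measurable (unit_borel \<Otimes>\<^sub>M unit_borel)"
  proof (rule borel_measurableI_less)
    fix y :: real
    let ?S = "space (unit_borel \<Otimes>\<^sub>M unit_borel)"
    have "quantile t u < y \<longleftrightarrow> (\<exists>q\<in>\<rat> \<inter> {0..1} \<inter> {..<y}. u \<le> k t q)" if "u \<le> 1" for t u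
    proof
      assume less: "quantile t u < y"
      show "\<exists>q\<in>\<rat> \<inter> {0..1} \<inter> {..<y}. u \<le> k t q"
      proof (cases "1 < y")
        case True
        then show ?thesis using k_1[of t] that by (intro bexI[of _ 1]) auto
      next
        case False
        obtain q where "q \<in> \<rat>" "quantile t u < q" "q < y"
          using Rats_dense_in_real[OF less] by blast
        then show ?thesis
          using quantile_less[of q u t] that False quantile_range[OF that, of t]
          by (intro bexI[of _ q]) auto
      qed
    next
      assume "\<exists>q\<in>\<rat> \<inter> {0..1} \<inter> {..<y}. u \<le> k t q"
      then show "quantile t u < y" using quantile_le by fastforce
    qed
    then have "{p \<in> ?S. (case p of (t, u) \<Rightarrow> quantile t u) < y} =
        (\<Union>q\<in>\<rat> \<inter> {0..1} \<inter> {..<y}. {p \<in> ?S. snd p \<le> k (fst p) q})"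
      by (fastforce simp: space_pair_measure)
    also have "\<dots> \<in> sets (unit_borel \<Otimes>\<^sub>M unit_borel)"
    proof (rule sets.countable_UN'')
      show "countable (\<rat> \<inter> {0..1} \<inter> {..<y})" by (rule countable_subset[OF _ countable_rat]) auto
      fix q assume "q \<in> \<rat> \<inter> {0..1} \<inter> {..<y}"
      then have [measurable]: "(\<lambda>x. k x q) \<in> borel_measurable unit_borel"
        by (intro k_measurable) auto
      have [measurable]: "(\<lambda>p. k (fst p) q) \<in> borel_measurable (unit_borel \<Otimes>\<^sub>M unit_borel)"
        by (rule measurable_compose[OF measurable_fst]) measurable
      have [measurable]: "(\<lambda>p. snd p) \<in> borel_measurable (unit_borel \<Otimes>\<^sub>M unit_borel)"
        by (rule measurable_compose[OF measurable_snd]) measurable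
      show "{p \<in> ?S. snd p \<le> k (fst p) q} \<in> sets (unit_borel \<Otimes>\<^sub>M unit_borel)"
        by measurable
    qed
    finally show "{p \<in> ?S. (case p of (t, u) \<Rightarrow> quantile t u) < y} \<in> sets (unit_borel \<Otimes>\<^sub>M unit_borel)" .
  qed
  then show ?thesis
    unfolding unit_borel_def[of] using quantile_range
    by (subst measurable_restrict_space2_iff) (auto simp: space_pair_measure unit_borel_def[symmetric])
qed

lemma quantile_measurable1 [measurable]: "t \<in> {0..1} \<Longrightarrow> quantile t \<in> unit_lebesgue \<rightarrow>\<^sub>M unit_borel"
  using measurable_Pair2[OF quantile_measurable, of t] by (simp cong: measurable_cong_sets)

lemma K_prob_kernel: "K \<in> unit_borel \<rightarrow>\<^sub>M prob_algebra unit_borel"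
proof -
  have "unit_lebesgue \<in> space (prob_algebra unit_borel)"
    by (simp add: space_prob_algebra unit.prob_space_axioms)
  then have "(\<lambda>t. unit_lebesgue) \<in> unit_borel \<rightarrow>\<^sub>M prob_algebra unit_borel"
    by (rule measurable_const)
  from measurable_distr_prob_space2[OF this quantile_measurable] show ?thesis
    by (simp add: K_def[abs_def])
qed

lemma law_prob_space: "prob_space law"
proof -
  interpret pair_prob_space unit_lebesgue unit_lebesgue ..
  show ?thesis unfolding law_def by (rule prob_space_distr) measurable
qed

lemma sets_law [simp, measurable_cong]: "sets law = sets (unit_borel \<Otimes>\<^sub>M unit_borel)"
  by (simp add: law_def)

lemma emeasure_law:
  assumes A [measurable]: "A \<in> sets (unit_borel \<Otimes>\<^sub>M unit_borel)"
  shows "emeasure law A = (\<integral>\<^sup>+t. emeasure (K t) (Pair t -` A) \<partial>unit_lebesgue)"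
proof -
  let ?f = "\<lambda>(t, u). (t, quantile t u)"
  have f [measurable]: "?f \<in> unit_lebesgue \<Otimes>\<^sub>M unit_lebesgue \<rightarrow>\<^sub>M unit_borel \<Otimes>\<^sub>M unit_borel"
    by measurable
  have "emeasure law A = emeasure (unit_lebesgue \<Otimes>\<^sub>M unit_lebesgue)
      (?f -` A \<inter> space (unit_lebesgue \<Otimes>\<^sub>M unit_lebesgue))"
    unfolding law_def by (rule emeasure_distr) measurable
  also have "\<dots> = (\<integral>\<^sup>+t. emeasure unit_lebesgue
      (Pair t -` (?f -` A \<inter> space (unit_lebesgue \<Otimes>\<^sub>M unit_lebesgue))) \<partial>unit_lebesgue)"
    by (rule unit.emeasure_pair_measure_alt[OF measurable_sets[OF f A]])
  also have "\<dots> = (\<integral>\<^sup>+t. emeasure (K t) (Pair t -` A) \<partial>unit_lebesgue)"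
  proof (rule nn_integral_cong)
    fix t assume t: "t \<in> space unit_lebesgue"
    have "Pair t -` (?f -` A \<inter> space (unit_lebesgue \<Otimes>\<^sub>M unit_lebesgue)) =
        quantile t -` (Pair t -` A) \<inter> space unit_lebesgue"
      using t by (auto simp: space_pair_measure)
    then show "emeasure unit_lebesgue (Pair t -` (?f -` A \<inter> space (unit_lebesgue \<Otimes>\<^sub>M unit_lebesgue)))
        = emeasure (K t) (Pair t -` A)"
      using t unfolding K_def by (subst emeasure_distr) (auto intro: sets_Pair1[OF A])
  qed
  finally show ?thesis .
qed

lemma emeasure_law_Times:
  assumes "E \<in> sets unit_borel" "F \<in> sets unit_borel"
  shows "emeasure law (E \<times> F) = (\<integral>\<^sup>+t\<in>E. emeasure (K t) F \<partial>unit_lebesgue)"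
proof -
  have "emeasure law (E \<times> F) = (\<integral>\<^sup>+t. emeasure (K t) (Pair t -` (E \<times> F)) \<partial>unit_lebesgue)"
    by (rule emeasure_law) (use assms in measurable)
  also have "\<dots> = (\<integral>\<^sup>+t\<in>E. emeasure (K t) F \<partial>unit_lebesgue)"
    by (intro nn_integral_cong) (auto simp: indicator_def)
  finally show ?thesis .
qed

lemma emeasure_unit_atMost: "c \<in> {0..1} \<Longrightarrow> emeasure unit_lebesgue {u \<in> {0..1}. u \<le> c} = ennreal c"
proof -
  assume "c \<in> {0..1}"
  then have "{u \<in> {0..1}. u \<le> c} = {0..c}" "{0..c} \<subseteq> {0..1}" by auto
  then show ?thesis using \<open>c \<in> {0..1}\<close> by (simp add: emeasure_unit_lebesgue)
qed

lemma emeasure_K: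
  "t \<in> {0..1} \<Longrightarrow> y \<in> {0..1} \<Longrightarrow> emeasure (K t) {0..y} = emeasure unit_lebesgue {u \<in> {0..1}. quantile t u \<le> y}"
proof -
  assume t: "t \<in> {0..1}" "y \<in> {0..1}"
  have "emeasure (K t) {0..y} = emeasure unit_lebesgue (quantile t -` {0..y} \<inter> space unit_lebesgue)"
    unfolding K_def using t by (intro emeasure_distr) auto
  also have "quantile t -` {0..y} \<inter> space unit_lebesgue = {u \<in> {0..1}. quantile t u \<le> y}"
    using quantile_range by auto
  finally show ?thesis .
qed

lemma quantile_sets: "t \<in> {0..1} \<Longrightarrow> {u \<in> {0..1}. quantile t u \<le> y} \<in> sets unit_lebesgue"
proof -
  assume t: "t \<in> {0..1}"
  have "{u \<in> space unit_lebesgue. quantile t u \<le> y} \<in> sets unit_lebesgue"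
    using measurable_compose[OF quantile_measurable1[OF t] unit_borel_inclusion] by measurable
  then show ?thesis by simp
qed

text \<open>
  Together with \<open>K_le\<close>: the distribution function of \<open>K t\<close> at \<open>y\<close> lies between \<open>k t y\<close> and the values of \<open>k t\<close> to the
  right of \<open>y\<close>.
\<close>

lemma K_ge: "t \<in> {0..1} \<Longrightarrow> y \<in> {0..1} \<Longrightarrow> ennreal (k t y) \<le> emeasure (K t) {0..y}"
proof -
  assume t: "t \<in> {0..1}" "y \<in> {0..1}"
  have "ennreal (k t y) = emeasure unit_lebesgue {u \<in> {0..1}. u \<le> k t y}"
    using emeasure_unit_atMost[OF k_range[OF t(2)]] by simp
  also have "\<dots> \<le> emeasure unit_lebesgue {u \<in> {0..1}. quantile t u \<le> y}"
    using t quantile_le by (intro emeasure_mono quantile_sets) auto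
  finally show ?thesis using emeasure_K[OF t] by simp
qed

lemma K_le:
  assumes t: "t \<in> {0..1}" "y \<in> {0..1}" and y': "y' \<in> {0..1}" "y < y' \<or> y' = 1"
  shows "emeasure (K t) {0..y} \<le> ennreal (k t y')"
proof -
  have "emeasure (K t) {0..y} = emeasure unit_lebesgue {u \<in> {0..1}. quantile t u \<le> y}"
    using emeasure_K[OF t] .
  also have "\<dots> \<le> emeasure unit_lebesgue {u \<in> {0..1}. u \<le> k t y'}"
  proof (rule emeasure_mono)
    show "{u \<in> {0..1}. u \<le> k t y'} \<in> sets unit_lebesgue"
      by (auto simp: sets_unit_borel_iff)
    show "{u \<in> {0..1}. quantile t u \<le> y} \<subseteq> {u \<in> {0..1}. u \<le> k t y'}"
      using quantile_less[of y' _ t] k_1 y' by fastforce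
  qed
  also have "\<dots> = ennreal (k t y')"
    using emeasure_unit_atMost[OF k_range[OF y'(1)]] .
  finally show ?thesis .
qed

lemma nn_integral_k:
  assumes x: "x \<in> {0..1}" and y: "y \<in> {0..1}"
  shows "(\<integral>\<^sup>+t\<in>{0..x}. ennreal (k t y) \<partial>unit_lebesgue) = ennreal (C x y)"
proof -
  have "(\<integral>\<^sup>+t\<in>{0..x}. ennreal (k t y) \<partial>unit_lebesgue) = (\<integral>\<^sup>+t. ennreal (k t y) * indicator {0..x} t \<partial>lborel)"
    unfolding nn_integral_unit_lebesgue
    by (intro nn_integral_cong) (use x in \<open>auto simp: indicator_def\<close>)
  also have "\<dots> = ennreal (C x y)"
    using k_range[OF y] k_has_integral[OF x y] by (intro nn_integral_has_integral_lebesgue') auto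
  finally show ?thesis .
qed

lemma C_nonneg: "x \<in> {0..1} \<Longrightarrow> y \<in> {0..1} \<Longrightarrow> 0 \<le> C x y"
  using k_range by (intro has_integral_nonneg[OF k_has_integral]) auto

text \<open>
  Integrating the bounds for \<open>K t\<close> puts the left-hand side between \<open>C x y\<close> and \<open>C x y'\<close> for all \<open>y' > y\<close>; now let \<open>y'\<close> tend
  to \<open>y\<close>.
\<close>

lemma law_cdf:
  assumes x: "x \<in> {0..1}" and y: "y \<in> {0..1}"
  shows "emeasure law ({0..x} \<times> {0..y}) = ennreal (C x y)"
proof (rule antisym)
  have eq: "emeasure law ({0..x} \<times> {0..y}) = (\<integral>\<^sup>+t\<in>{0..x}. emeasure (K t) {0..y} \<partial>unit_lebesgue)"
    using x y by (intro emeasure_law_Times) auto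
  have "(\<integral>\<^sup>+t\<in>{0..x}. ennreal (k t y) \<partial>unit_lebesgue) \<le> (\<integral>\<^sup>+t\<in>{0..x}. emeasure (K t) {0..y} \<partial>unit_lebesgue)"
    using x y K_ge by (intro nn_integral_mono mult_right_mono) auto
  then show "ennreal (C x y) \<le> emeasure law ({0..x} \<times> {0..y})"
    using nn_integral_k[OF x y] eq by simp
  have le: "emeasure law ({0..x} \<times> {0..y}) \<le> ennreal (C x y')"
    if "y' \<in> {0..1}" "y < y' \<or> y' = 1" for y'
  proof -
    have "(\<integral>\<^sup>+t\<in>{0..x}. emeasure (K t) {0..y} \<partial>unit_lebesgue) \<le> (\<integral>\<^sup>+t\<in>{0..x}. ennreal (k t y') \<partial>unit_lebesgue)"
      using x y that K_le by (intro nn_integral_mono mult_right_mono) auto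
    then show ?thesis
      using nn_integral_k[OF x that(1)] eq by simp
  qed
  show "emeasure law ({0..x} \<times> {0..y}) \<le> ennreal (C x y)"
  proof (cases "y = 1")
    case False
    then have "y < 1" using y by auto
    have "(C x \<longlongrightarrow> C x y) (at_right y)"
      by (rule tendsto_at_right_unit[OF C_cont_right[OF x]]) (use y \<open>y < 1\<close> in auto)
    then have "((\<lambda>y'. ennreal (C x y')) \<longlongrightarrow> ennreal (C x y)) (at_right y)"
      by (rule tendsto_ennrealI)
    then show ?thesis
    proof (rule tendsto_lowerbound)
      show "\<forall>\<^sub>F y' in at_right y. emeasure law ({0..x} \<times> {0..y}) \<le> ennreal (C x y')"
        using eventually_at_right_between[OF \<open>y < 1\<close>] by eventually_elim (rule le, use y in auto)
    qed simp
  qed (use le[of 1] y in auto)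
qed

lemma copula_law_eq: "copula_law C = law"
  unfolding copula_law_def
proof (rule the_equality)
  interpret law: prob_space law by (rule law_prob_space)
  show "prob_space law \<and> sets law = sets (unit_borel \<Otimes>\<^sub>M unit_borel) \<and>
    (\<forall>x\<in>{0..1}. \<forall>y\<in>{0..1}. Sigma_Algebra.measure law ({0..x} \<times> {0..y}) = C x y)"
    using law_cdf C_nonneg by (auto simp: law.prob_space_axioms measure_def)
  fix M assume M: "prob_space M \<and> sets M = sets (unit_borel \<Otimes>\<^sub>M unit_borel) \<and>
    (\<forall>x\<in>{0..1}. \<forall>y\<in>{0..1}. Sigma_Algebra.measure M ({0..x} \<times> {0..y}) = C x y)"
  then interpret M: prob_space M by simp
  show "M = law"
  proof (rule unit_square_measure_eqI)
    fix x y :: real assume xy: "x \<in> {0..1}" "y \<in> {0..1}"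
    then show "emeasure M ({0..x} \<times> {0..y}) = emeasure law ({0..x} \<times> {0..y})"
      using M law_cdf[OF xy] by (simp add: M.emeasure_eq_measure)
  qed (use M in \<open>auto simp: M.finite_measure_axioms\<close>)
qed

lemma K_markov_kernel: "is_markov_kernel C K"
  unfolding is_markov_kernel_def copula_law_eq using K_prob_kernel emeasure_law_Times by blast

lemma markov_kernel: "is_markov_kernel C (markov_kernel C)"
  unfolding markov_kernel_def by (rule someI[of "is_markov_kernel C", OF K_markov_kernel])

end

text \<open>
  The selected kernel is arbitrary, but both sides are densities of the measure \<open>E \<mapsto> law (E \<times> {0..y})\<close>, and densities are unique
  almost everywhere.
\<close>

lemma (in conditional_cdf) markov_kernel_cdf:
  assumes y: "y \<in> {0..1}"
  shows "AE t in unit_lebesgue. measure (markov_kernel C t) {0..y} = k t y"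
proof -
  define M where "M = markov_kernel C"
  have M [measurable]: "M \<in> unit_borel \<rightarrow>\<^sub>M prob_algebra unit_borel"
    and eq: "\<And>E F. E \<in> sets unit_borel \<Longrightarrow> F \<in> sets unit_borel \<Longrightarrow>
      emeasure law (E \<times> F) = (\<integral>\<^sup>+x\<in>E. emeasure (M x) F \<partial>unit_lebesgue)"
    using markov_kernel unfolding is_markov_kernel_def copula_law_eq M_def by auto
  have [measurable]: "{0..y} \<in> sets unit_borel" using y by simp
  have m1 [measurable]: "(\<lambda>t. ennreal (k t y)) \<in> borel_measurable unit_lebesgue"
    using k_measurable[OF y] by (simp cong: measurable_cong_sets)
  have m2 [measurable]: "(\<lambda>t. emeasure (M t) {0..y}) \<in> borel_measurable unit_lebesgue"
    using measurable_emeasure_kernel[OF measurable_prob_algebraD[OF M], of "{0..y}"] y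
    by (simp cong: measurable_cong_sets)
  have "density unit_lebesgue (\<lambda>t. emeasure (M t) {0..y}) = density unit_lebesgue (\<lambda>t. ennreal (k t y))"
  proof (rule sym, rule unit_measure_eqI)
    show "finite_measure (density unit_lebesgue (\<lambda>t. ennreal (k t y)))"
      using nn_integral_k[of 1 y] y by (intro finite_measureI) (simp add: emeasure_density)
    fix x :: real assume x: "x \<in> {0..1}"
    then show "emeasure (density unit_lebesgue (\<lambda>t. ennreal (k t y))) {0..x} =
        emeasure (density unit_lebesgue (\<lambda>t. emeasure (M t) {0..y})) {0..x}"
      using nn_integral_k[OF x y] law_cdf[OF x y] eq[of "{0..x}" "{0..y}"] y
      by (simp add: emeasure_density)
  qed auto
  then have "AE t in unit_lebesgue. emeasure (M t) {0..y} = ennreal (k t y)"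
    by (subst (asm) unit.density_unique_iff) auto
  then show ?thesis
    unfolding M_def[symmetric]
    by eventually_elim (use k_range[OF y] in \<open>auto simp: measure_def\<close>)
qed

section \<open>Logarithmic derivatives and Kendall distribution functions of generators\<close>

lemma eventually_less_lim:
  fixes f h :: "nat \<Rightarrow> real"
  assumes "f \<longlonglongrightarrow> a" "h \<longlonglongrightarrow> b" "a < b"
  shows "\<forall>\<^sub>F n in sequentially. f n < h n"
proof -
  have "\<forall>\<^sub>F n in sequentially. 0 < h n - f n"
    by (rule order_tendstoD[OF tendsto_diff[OF assms(2,1)]]) (use assms(3) in simp)
  then show ?thesis by eventually_elim simp
qed

lemma divide_le_divide_of_le_mult:
  fixes p q c d :: real
  assumes "0 \<le> p" "0 < q" "0 < d" "d \<le> q * c"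
  shows "p / q \<le> p * c / d"
  using mult_left_mono[OF assms(4,1)] assms by (simp add: field_simps)

lemma dyadic_between:
  fixes u v :: real
  assumes "0 \<le> u" "u < v"
  obtains m j :: nat where "u < real (Suc m) / 2 ^ j" "real (Suc m) / 2 ^ j < v"
proof -
  obtain j where j: "(1/2 :: real) ^ j < v - u"
    using real_arch_pow_inv[of "v - u" "1/2"] assms by auto
  define m where "m = nat \<lfloor>u * 2 ^ j\<rfloor>"
  have m: "real m \<le> u * 2 ^ j" "u * 2 ^ j < real m + 1"
    using assms unfolding m_def by (auto simp: of_nat_nat)
  have "u < real (Suc m) / 2 ^ j"
    using m by (simp add: field_simps)
  moreover have "real (Suc m) / 2 ^ j \<le> u + (1/2) ^ j"
    using m by (simp add: field_simps power_one_over)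
  ultimately show ?thesis using that[of m j] j by linarith
qed

text \<open>
  Shown to be the Kendall distribution function on \<open>(0,1)\<close> in \<open>kendall_cdf_eq\<close>.
\<close>

definition kendall_formula :: "(real \<Rightarrow> ennreal) \<Rightarrow> real \<Rightarrow> real" where
  "kendall_formula \<phi> x = x - gen_fun \<phi> x / right_deriv \<phi> x"

context archimedean_generator
begin

lemma discont_D_negligible: "negligible ({0<..<1} - cont_right_deriv \<phi>)"
  using countable_imp_null_set_lborel[OF discont_D_countable]
  by (simp add: negligible_iff_null_sets null_sets_completionI)

lemma kendall_formula_mono:
  assumes "0 < x" "x \<le> y" "y < 1"
  shows "kendall_formula \<phi> x \<le> kendall_formula \<phi> y"
proof (cases "x = y")
  case False
  then have xy: "x < y" using assms by simp
  have D: "D x \<le> D y" "D y < 0" "D x < 0" using D_mono[of x y] D_neg assms by auto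
  have "D x * (y - x) \<le> g y - g x"
    using D_le_slope[of x y] xy assms by (simp add: le_divide_eq)
  then have "g y - D x * (y - x) \<ge> g x" by simp
  then have "(g y - D x * (y - x)) / D x \<le> g x / D x"
    using D by (simp add: divide_right_mono_neg)
  then have "g y / D x - (y - x) \<le> g x / D x"
    using D by (simp add: diff_divide_distrib)
  moreover have "g y / D y \<le> g y / D x"
    using D mult_left_mono[of "D x" "D y" "g y"] by (simp add: divide_simps)
  ultimately show ?thesis by (simp add: kendall_formula_def)
qed simp

text \<open>
  On \<open>[l,r]\<close> the generator is at least \<open>g r\<close> and its derivative is at most \<open>\<bar>D l\<bar>\<close> in absolute value.
\<close>

lemma kendall_formula_lower:
  assumes "0 < l" "l \<le> x" "x \<le> r" "r < 1"
  shows "x + g r / \<bar>D l\<bar> \<le> kendall_formula \<phi> x"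
proof -
  have D: "D l \<le> D x" "D x < 0" using D_mono[of l x] D_neg assms by auto
  have "g r / \<bar>D l\<bar> \<le> g x / \<bar>D x\<bar>"
    using D g_le[of x r] assms by (intro frac_le) auto
  then show ?thesis using D by (simp add: kendall_formula_def)
qed

lemma log_derivative_has_integral:
  assumes "0 < l" "l \<le> r" "r < 1"
  shows "((\<lambda>t. D t / g t) has_integral ln (g r) - ln (g l)) {l..r}"
proof -
  have pos: "0 < g r" using g_pos assms by simp
  obtain L where "L-lipschitz_on {l..1} g" using g_lipschitz assms(1) by blast
  then have L: "L-lipschitz_on {l..r} g" by (rule lipschitz_on_subset) (use assms in auto)
  have L0: "0 \<le> L" using lipschitz_on_nonneg L by blast
  have *: "ln (g x) - ln (g y) \<le> L / g r * \<bar>x - y\<bar>" if "x \<in> {l..r}" "y \<in> {l..r}" for x y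
  proof -
    have g: "0 < g x" "0 < g y" "g r \<le> g y"
      using that assms g_pos[of x] g_pos[of y] g_le[of y r] by auto
    have "ln (g x) - ln (g y) \<le> (g x - g y) / g y"
      using g by (intro ln_diff_le)
    also have "\<dots> \<le> \<bar>g x - g y\<bar> / g y"
      using g by (intro divide_right_mono) auto
    also have "\<dots> \<le> (L * \<bar>x - y\<bar>) / g r"
      using lipschitz_onD[OF L that] g pos L0 by (intro frac_le) (auto simp: dist_real_def)
    finally show ?thesis by simp
  qed
  have "(L / g r)-lipschitz_on {l..r} (\<lambda>x. ln (g x))"
  proof (rule lipschitz_onI)
    fix x y assume "x \<in> {l..r}" "y \<in> {l..r}"
    then show "dist (ln (g x)) (ln (g y)) \<le> L / g r * dist x y"
      using *[of x y] *[of y x] by (simp add: dist_real_def abs_minus_commute abs_le_iff)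
  qed (use L0 pos in simp)
  then show ?thesis
  proof (rule has_integral_right_derivative[OF assms(2), where N = "{}"])
    fix x assume "x \<in> {l..<r} - {}"
    then have x: "0 < x" "x < 1" "0 < g x" using assms g_pos by auto
    show "((\<lambda>x. ln (g x)) has_real_derivative D x / g x) (at_right x)"
      by (rule derivative_eq_intros D_has_derivative x)+ simp
  qed simp
qed

end

section \<open>Convergence of the copulas implies convergence of the generators\<close>

locale generator_sequence = archimedean_generator \<phi> for \<phi> +
  fixes \<phi>s :: "nat \<Rightarrow> real \<Rightarrow> ennreal"
  assumes gens: "generator (\<phi>s n)"
begin

sublocale seq: archimedean_generator "\<phi>s n" for n
  by unfold_locales (rule gens)

abbreviation gs :: "nat \<Rightarrow> real \<Rightarrow> real" where "gs n \<equiv> gen_fun (\<phi>s n)"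
abbreviation Ds :: "nat \<Rightarrow> real \<Rightarrow> real" where "Ds n \<equiv> right_deriv (\<phi>s n)"
abbreviation Cs :: "nat \<Rightarrow> real \<Rightarrow> real \<Rightarrow> real" where "Cs n \<equiv> arch_copula (\<phi>s n)"
abbreviation ks :: "nat \<Rightarrow> real \<Rightarrow> real \<Rightarrow> real" where "ks n \<equiv> arch_kernel (\<phi>s n)"

lemma generator_tendsto_iff:
  assumes "x \<in> {0<..1}"
  shows "(\<lambda>n. \<phi>s n x) \<longlonglongrightarrow> \<phi> x \<longleftrightarrow> (\<lambda>n. gs n x) \<longlonglongrightarrow> g x"
  using phi_eq[of x] seq.phi_eq[of x] assms by (simp add: tendsto_ennreal_iff)

context
  assumes conv: "\<And>x y. x \<in> {0..1} \<Longrightarrow> y \<in> {0..1} \<Longrightarrow> (\<lambda>n. Cs n x y) \<longlonglongrightarrow> C x y"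
begin

lemma eventually_sum_less:
  assumes xyz: "x \<in> {0<..1}" "y \<in> {0<..1}" "z \<in> {0<..1}" and less: "g x + g y < g z"
  shows "\<forall>\<^sub>F n in sequentially. gs n x + gs n y < gs n z"
proof -
  have "z \<le> C x y" using C_ge_iff_g[OF xyz] less by simp
  moreover from this have "g (C x y) < g z" using g_C[of x y] xyz less by auto
  ultimately have "z < C x y" using xyz by (cases "z = C x y") auto
  then have "\<forall>\<^sub>F n in sequentially. z < Cs n x y"
    using xyz by (intro order_tendstoD[OF conv]) auto
  then show ?thesis
  proof eventually_elim
    case (elim n)
    then show ?case using seq.g_C[of x y n] seq.g_less[of z "Cs n x y" n] xyz by auto
  qed
qed

lemma eventually_sum_greater:
  assumes xyz: "x \<in> {0<..1}" "y \<in> {0<..1}" "z \<in> {0<..1}" and less: "g z < g x + g y"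
  shows "\<forall>\<^sub>F n in sequentially. gs n z < gs n x + gs n y"
proof -
  have "C x y < z" using C_ge_iff_g[OF xyz] less by simp
  then have "\<forall>\<^sub>F n in sequentially. Cs n x y < z"
    using xyz by (intro order_tendstoD[OF conv]) auto
  then show ?thesis
    by eventually_elim (use seq.C_ge_iff_g[OF xyz] in \<open>simp add: not_le[symmetric]\<close>)
qed

text \<open>
  The number \<open>s\<close> is separating if every strict comparison of \<open>g x\<close> with \<open>s\<close> eventually holds along the sequence as well.  If a dense
  set of numbers is separating, the generators converge pointwise.
\<close>

definition separating :: "real \<Rightarrow> bool" where
  "separating s \<longleftrightarrow> 0 < s \<and> (\<forall>x\<in>{0<..1}.
     (g x < s \<longrightarrow> (\<forall>\<^sub>F n in sequentially. gs n x < s)) \<and>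
     (s < g x \<longrightarrow> (\<forall>\<^sub>F n in sequentially. s < gs n x)))"

lemma separatingD:
  assumes "separating s" "x \<in> {0<..1}"
  shows "g x < s \<Longrightarrow> \<forall>\<^sub>F n in sequentially. gs n x < s"
    and "s < g x \<Longrightarrow> \<forall>\<^sub>F n in sequentially. s < gs n x"
  using assms unfolding separating_def by auto

lemma separating_1: "separating 1"
proof -
  have "g x < 1 \<longleftrightarrow> 1/2 < x" "1 < g x \<longleftrightarrow> x < 1/2" if "x \<in> {0<..1}" for x
    using g_less_iff[of "1/2" x] g_less_iff[of x "1/2"] that by auto
  moreover have "gs n x < 1 \<longleftrightarrow> 1/2 < x" "1 < gs n x \<longleftrightarrow> x < 1/2" if "x \<in> {0<..1}" for x n
    using seq.g_less_iff[of "1/2" x n] seq.g_less_iff[of x "1/2" n] that by auto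
  ultimately show ?thesis unfolding separating_def by simp
qed

lemma one_less_phi_0: "1 < \<phi> 0"
  using g_less_phi_0[of "1/2"] by simp

text \<open>
  To compare \<open>g x\<close> with \<open>s/2\<close>, put a value \<open>g z\<close> strictly between \<open>2 * g x\<close> and \<open>s\<close>, and use that \<open>s\<close> is separating for \<open>z\<close>.  The
  assumption \<open>s \<le> 1\<close> ensures that such a value exists: the smaller of the two numbers is then below \<open>\<phi> 0\<close>, which
  may be finite but exceeds \<open>\<phi> (1/2) = 1\<close>.
\<close>

lemma separating_half:
  assumes s: "separating s" "s \<le> 1"
  shows "separating (s / 2)"
  unfolding separating_def
proof (intro conjI ballI impI)
  show s0: "0 < s / 2" using s by (simp add: separating_def)
  have below: "ennreal u < \<phi> 0" if "u \<le> 1" for u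
    using order_le_less_trans[OF ennreal_leI[OF that]] one_less_phi_0 by simp
  fix x :: real assume x: "x \<in> {0<..1}"
  show "\<forall>\<^sub>F n in sequentially. gs n x < s / 2" if less: "g x < s / 2"
  proof -
    obtain z where z: "z \<in> {0<..1}" "2 * g x < g z" "g z < s"
      using g_between[of "2 * g x" s] below[of "2 * g x"] less s by auto
    then have "g x + g x < g z" by simp
    from separatingD(1)[OF s(1) z(1,3)] eventually_sum_less[OF x x z(1) this]
    show ?thesis by eventually_elim simp
  qed
  show "\<forall>\<^sub>F n in sequentially. s / 2 < gs n x" if less: "s / 2 < g x"
  proof -
    obtain z where z: "z \<in> {0<..1}" "s < g z" "g z < 2 * g x"
      using g_between[of s "2 * g x"] below[of s] less s s0 by auto
    then have "g z < g x + g x" by simp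
    from separatingD(2)[OF s(1) z(1,2)] eventually_sum_greater[OF x x z(1) this]
    show ?thesis by eventually_elim simp
  qed
qed

lemma separating_add:
  assumes s: "separating s" and t: "separating t"
  shows "separating (s + t)"
  unfolding separating_def
proof (intro conjI ballI impI)
  have st: "0 < s" "0 < t" using s t by (auto simp: separating_def)
  then show "0 < s + t" by simp
  fix x :: real assume x: "x \<in> {0<..1}"
  have below: "ennreal u < \<phi> 0" if "u \<le> g x" for u
    using order_le_less_trans[OF ennreal_leI[OF that] g_less_phi_0[OF x]] .
  \<comment> \<open>split the value g x in the proportion of s to t\<close>
  define a b where "a = g x * (s / (s + t))" and "b = g x * (t / (s + t))"
  have ab: "a + b = g x" "0 \<le> a" "0 \<le> b"
    using st unfolding a_def b_def by (auto simp: distrib_left[symmetric] add_divide_distrib[symmetric])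
  show "\<forall>\<^sub>F n in sequentially. gs n x < s + t" if less: "g x < s + t"
  proof -
    have "a < s" "b < t"
      using st mult_strict_left_mono[OF less st(1)] mult_strict_left_mono[OF less st(2)]
      by (auto simp: a_def b_def field_simps)
    obtain y where y: "y \<in> {0<..1}" "a < g y" "g y < s"
      using g_between[of a s] below[of a] ab \<open>a < s\<close> by auto
    obtain z where z: "z \<in> {0<..1}" "b < g z" "g z < t"
      using g_between[of b t] below[of b] ab \<open>b < t\<close> by auto
    have "g x < g y + g z" using y z ab by linarith
    from separatingD(1)[OF s y(1,3)] separatingD(1)[OF t z(1,3)]
      eventually_sum_greater[OF y(1) z(1) x this]
    show ?thesis by eventually_elim linarith
  qed
  show "\<forall>\<^sub>F n in sequentially. s + t < gs n x" if less: "s + t < g x"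
  proof -
    have "s < a" "t < b"
      using st mult_strict_left_mono[OF less st(1)] mult_strict_left_mono[OF less st(2)]
      by (auto simp: a_def b_def field_simps)
    obtain y where y: "y \<in> {0<..1}" "s < g y" "g y < a"
      using g_between[of s a] below[of s] ab \<open>s < a\<close> st by auto
    obtain z where z: "z \<in> {0<..1}" "t < g z" "g z < b"
      using g_between[of t b] below[of t] ab \<open>t < b\<close> st by auto
    have "g y + g z < g x" using y z ab by linarith
    from separatingD(2)[OF s y(1,2)] separatingD(2)[OF t z(1,2)]
      eventually_sum_less[OF y(1) z(1) x this]
    show ?thesis by eventually_elim linarith
  qed
qed

lemma separating_dyadic: "separating (real (Suc m) / 2 ^ j)"
proof -
  have pow: "separating (1 / 2 ^ j)"
  proof (induction j)
    case (Suc j)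
    then show ?case using separating_half[of "1 / 2 ^ j"] by (simp add: mult.commute)
  qed (simp add: separating_1)
  show ?thesis
  proof (induction m)
    case (Suc m)
    then show ?case using separating_add[OF Suc pow] by (simp add: add_divide_distrib add_ac)
  qed (use pow in simp)
qed

lemma generators_tendsto_if_copulas:
  assumes x: "x \<in> {0<..1}"
  shows "(\<lambda>n. gs n x) \<longlonglongrightarrow> g x"
proof (rule order_tendstoI)
  fix a assume a: "a < g x"
  show "\<forall>\<^sub>F n in sequentially. a < gs n x"
  proof (cases "a < 0")
    case True
    then show ?thesis by (intro always_eventually) (auto intro: less_le_trans)
  next
    case False
    then obtain m j :: nat where mj: "a < real (Suc m) / 2 ^ j" "real (Suc m) / 2 ^ j < g x"
      using dyadic_between[of a "g x"] a by auto
    show ?thesis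
      using separatingD(2)[OF separating_dyadic x mj(2)] by eventually_elim (use mj(1) in linarith)
  qed
next
  fix a assume a: "g x < a"
  then obtain m j :: nat where mj: "g x < real (Suc m) / 2 ^ j" "real (Suc m) / 2 ^ j < a"
    using dyadic_between[of "g x" a] by auto
  show "\<forall>\<^sub>F n in sequentially. gs n x < a"
    using separatingD(1)[OF separating_dyadic x mj(1)] by eventually_elim (use mj(2) in linarith)
qed

end

section \<open>Convergence of the Kendall distribution functions implies convergence of the generators\<close>

text \<open>
  At each continuity point \<open>s\<close> the convergence gives \<open>F\<^sub>n s > s + 3\<rho>/4\<close> eventually, and by monotonicity of \<open>F\<^sub>n\<close> this remains useful on
  \<open>(s, s + \<rho>/4)\<close>, where it says \<open>F\<^sub>n t > t + \<rho>/2\<close>.  Finitely many of these intervals cover \<open>[l,r]\<close>.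
\<close>

lemma kendall_uniform_lower:
  assumes conv: "\<And>x. x \<in> cont_right_deriv \<phi> \<Longrightarrow> (\<lambda>n. kendall_formula (\<phi>s n) x) \<longlonglongrightarrow> kendall_formula \<phi> x"
    and lr: "0 < l" "l < r" "r < 1"
  obtains \<delta> where "0 < \<delta>" "\<forall>\<^sub>F n in sequentially. \<forall>t\<in>{l..r}. t + \<delta> \<le> kendall_formula (\<phi>s n) t"
proof -
  \<comment> \<open>the lower bound on [l/2, r], because the intervals that cover l start to the left of l\<close>
  define \<rho> where "\<rho> = g r / \<bar>D (l/2)\<bar>"
  have \<rho>: "0 < \<rho>" unfolding \<rho>_def using g_pos[of r] D_neg[of "l/2"] lr by (intro divide_pos_pos) auto
  define S where "S = cont_right_deriv \<phi> \<inter> {l/2<..<r}"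
  define J where "J s = {s<..<s + \<rho>/4}" for s
  have "{l..r} \<subseteq> (\<Union>s\<in>S. J s)"
  proof
    fix t assume t: "t \<in> {l..r}"
    have "0 \<le> max (l/2) (t - \<rho>/4)" "max (l/2) (t - \<rho>/4) < t" "t \<le> 1"
      using t lr \<rho> by auto
    then obtain s where "s \<in> cont_right_deriv \<phi>" "max (l/2) (t - \<rho>/4) < s" "s < t"
      by (rule cont_D_dense)
    then show "t \<in> (\<Union>s\<in>S. J s)"
      using t by (auto simp: S_def J_def intro!: bexI[of _ s])
  qed
  then obtain S' where S': "S' \<subseteq> S" "finite S'" "{l..r} \<subseteq> (\<Union>s\<in>S'. J s)"
    using compactE_image[of "{l..r}" S J] by (auto simp: J_def)
  have "\<forall>\<^sub>F n in sequentially. s + 3 * \<rho> / 4 < kendall_formula (\<phi>s n) s" if "s \<in> S'" for s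
  proof (rule order_tendstoD[OF conv])
    have "s \<in> S" using that S' by blast
    then show "s \<in> cont_right_deriv \<phi>" "s + 3 * \<rho> / 4 < kendall_formula \<phi> s"
      using kendall_formula_lower[of "l/2" s r] lr \<rho> by (auto simp: S_def \<rho>_def)
  qed
  then have "\<forall>\<^sub>F n in sequentially. \<forall>s\<in>S'. s + 3 * \<rho> / 4 < kendall_formula (\<phi>s n) s"
    using S'(2) by (intro eventually_ball_finite) auto
  then have "\<forall>\<^sub>F n in sequentially. \<forall>t\<in>{l..r}. t + \<rho>/2 \<le> kendall_formula (\<phi>s n) t"
  proof eventually_elim
    case (elim n)
    show ?case
    proof
      fix t assume t: "t \<in> {l..r}"
      then obtain s where s: "s \<in> S'" "s < t" "t < s + \<rho>/4" using S'(3) by (auto simp: J_def)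
      then have "0 < s" using S'(1) lr by (auto simp: S_def)
      then have "kendall_formula (\<phi>s n) s \<le> kendall_formula (\<phi>s n) t"
        using seq.kendall_formula_mono[of s t n] s t lr by auto
      moreover have "s + 3 * \<rho> / 4 < kendall_formula (\<phi>s n) s" using elim s by blast
      ultimately show "t + \<rho>/2 \<le> kendall_formula (\<phi>s n) t" using s by linarith
    qed
  qed
  then show ?thesis using that[of "\<rho>/2"] \<rho> by auto
qed

lemma ln_increment_tendsto:
  assumes conv: "\<And>x. x \<in> cont_right_deriv \<phi> \<Longrightarrow> (\<lambda>n. kendall_formula (\<phi>s n) x) \<longlonglongrightarrow> kendall_formula \<phi> x"
    and lr: "0 < l" "l < r" "r < 1"
  shows "(\<lambda>n. ln (gs n r) - ln (gs n l)) \<longlonglongrightarrow> ln (g r) - ln (g l)"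
proof -
  obtain \<delta> where \<delta>: "0 < \<delta>"
    "\<forall>\<^sub>F n in sequentially. \<forall>t\<in>{l..r}. t + \<delta> \<le> kendall_formula (\<phi>s n) t"
    using kendall_uniform_lower[OF conv lr] by auto
  let ?N = "{0<..<1} - cont_right_deriv \<phi>"
  have "\<forall>\<^sub>F n in sequentially. ((\<lambda>t. Ds n t / gs n t) has_integral ln (gs n r) - ln (gs n l)) {l..r} \<and>
      (\<forall>t\<in>{l..r} - ?N. \<bar>Ds n t / gs n t\<bar> \<le> 1 / \<delta>)"
    using \<delta>(2)
  proof eventually_elim
    case (elim n)
    have "\<bar>Ds n t / gs n t\<bar> \<le> 1 / \<delta>" if t: "t \<in> {l..r}" for t
    proof -
      have D: "Ds n t < 0" "0 < gs n t" using seq.D_neg[of t n] seq.g_pos[of t n] t lr by auto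
      have "t + \<delta> \<le> kendall_formula (\<phi>s n) t" using elim t by blast
      then have "\<delta> \<le> gs n t / (- Ds n t)" using D by (simp add: kendall_formula_def)
      then have "\<delta> * (- Ds n t) \<le> gs n t" using D by (subst (asm) le_divide_eq) auto
      then have "(- Ds n t) / gs n t \<le> 1 / \<delta>" using D \<delta>(1) by (simp add: field_simps)
      then show ?thesis using D by (simp add: abs_divide)
    qed
    then show ?case using seq.log_derivative_has_integral[of l r n] lr by auto
  qed
  moreover have "negligible ?N" by (rule discont_D_negligible)
  moreover have "(\<lambda>n. Ds n t / gs n t) \<longlonglongrightarrow> D t / g t" if "t \<in> {l..r} - ?N" for t
  proof -
    have t: "t \<in> cont_right_deriv \<phi>" "0 < t" "t < 1" using that lr by auto
    have "(\<lambda>n. t - kendall_formula (\<phi>s n) t) \<longlonglongrightarrow> t - kendall_formula \<phi> t"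
      by (intro tendsto_intros conv t)
    then have "(\<lambda>n. gs n t / Ds n t) \<longlonglongrightarrow> g t / D t" by (simp add: kendall_formula_def)
    then have "(\<lambda>n. inverse (gs n t / Ds n t)) \<longlonglongrightarrow> inverse (g t / D t)"
      using D_neg[of t] g_pos[of t] t by (intro tendsto_inverse) auto
    then show ?thesis by simp
  qed
  ultimately have "(\<lambda>n. ln (gs n r) - ln (gs n l)) \<longlonglongrightarrow> integral {l..r} (\<lambda>t. D t / g t)"
    by (rule dominated_convergence_ae_interval(2))
  also have "integral {l..r} (\<lambda>t. D t / g t) = ln (g r) - ln (g l)"
    using log_derivative_has_integral[of l r] lr by (intro integral_unique) auto
  finally show ?thesis .
qed

lemma generators_tendsto_if_kendall:
  assumes conv: "\<And>x. x \<in> cont_right_deriv \<phi> \<Longrightarrow> (\<lambda>n. kendall_formula (\<phi>s n) x) \<longlonglongrightarrow> kendall_formula \<phi> x"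
    and x: "x \<in> {0<..1}"
  shows "(\<lambda>n. gs n x) \<longlonglongrightarrow> g x"
proof (cases "x = 1 \<or> x = 1/2")
  case False
  have "(\<lambda>n. ln (gs n x)) \<longlonglongrightarrow> ln (g x)"
  proof (cases "x < 1/2")
    case True
    then show ?thesis
      using tendsto_minus[OF ln_increment_tendsto[OF conv, of x "1/2"]] x by simp
  next
    case False
    then show ?thesis
      using ln_increment_tendsto[OF conv, of "1/2" x] x \<open>\<not> (x = 1 \<or> x = 1/2)\<close> by simp
  qed
  then have "(\<lambda>n. exp (ln (gs n x))) \<longlonglongrightarrow> exp (ln (g x))" by (rule tendsto_exp)
  then show ?thesis using g_pos[of x] seq.g_pos[of x] x False by simp
next
  case True
  then show ?thesis by (elim disjE; hypsubst; simp)
qed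

section \<open>Convergence of the derivatives implies convergence of the generators\<close>

text \<open>
  A single continuity point \<open>a < x\<close> provides the bound: on \<open>[x,1)\<close> the derivatives lie between their value at \<open>a\<close> and \<open>0\<close>.
  The point \<open>1\<close> joins the exceptional set because the derivative is not defined there.
\<close>

lemma generators_tendsto_if_derivatives:
  assumes conv: "\<And>x. x \<in> cont_right_deriv \<phi> \<Longrightarrow> (\<lambda>n. Ds n x) \<longlonglongrightarrow> D x"
    and x: "x \<in> {0<..1}"
  shows "(\<lambda>n. gs n x) \<longlonglongrightarrow> g x"
proof -
  obtain a where a: "a \<in> cont_right_deriv \<phi>" "0 < a" "a < x"
    using cont_D_dense[of 0 x] x by auto
  let ?N = "insert 1 ({0<..<1} - cont_right_deriv \<phi>)"
  have "\<forall>\<^sub>F n in sequentially. D a - 1 < Ds n a"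
    by (rule order_tendstoD[OF conv[OF a(1)]]) simp
  then have "\<forall>\<^sub>F n in sequentially. (Ds n has_integral gs n 1 - gs n x) {x..1} \<and>
      (\<forall>t\<in>{x..1} - ?N. \<bar>Ds n t\<bar> \<le> 1 - D a)"
  proof eventually_elim
    case (elim n)
    have "\<bar>Ds n t\<bar> \<le> 1 - D a" if "t \<in> {x..1} - ?N" for t
      using elim that seq.D_mono[of a t n] seq.D_neg[of t n] a by auto
    then show ?case using seq.D_has_integral[of x 1 n] x by auto
  qed
  moreover have "negligible ?N"
    using discont_D_negligible by simp
  moreover have "(\<lambda>n. Ds n t) \<longlonglongrightarrow> D t" if "t \<in> {x..1} - ?N" for t
    using that x by (intro conv) auto
  ultimately have "(\<lambda>n. gs n 1 - gs n x) \<longlonglongrightarrow> integral {x..1} D"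
    by (rule dominated_convergence_ae_interval(2))
  also have "integral {x..1} D = g 1 - g x"
    using D_has_integral[of x 1] x by (intro integral_unique) auto
  finally have "(\<lambda>n. - gs n x) \<longlonglongrightarrow> - g x" by simp
  then show ?thesis by (rule tendsto_minus_cancel)
qed

section \<open>Consequences of the convergence of the generators\<close>

context
  assumes conv: "\<And>x. x \<in> {0<..1} \<Longrightarrow> (\<lambda>n. gs n x) \<longlonglongrightarrow> g x"
begin

lemma copulas_tendsto:
  assumes x: "x \<in> {0..1}" and y: "y \<in> {0..1}"
  shows "(\<lambda>n. Cs n x y) \<longlonglongrightarrow> C x y"
proof (cases "x = 0 \<or> y = 0")
  case False
  then have xy: "x \<in> {0<..1}" "y \<in> {0<..1}" using x y by auto
  have sum: "(\<lambda>n. gs n x + gs n y) \<longlonglongrightarrow> g x + g y"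
    by (intro tendsto_add conv xy)
  show ?thesis
  proof (rule order_tendstoI)
    fix a assume a: "a < C x y"
    show "\<forall>\<^sub>F n in sequentially. a < Cs n x y"
    proof (cases "a < 0")
      case True
      then show ?thesis
        using seq.C_range[OF x y] by (intro always_eventually) (auto intro: less_le_trans)
    next
      case False
      define z where "z = (a + C x y) / 2"
      have z: "a < z" "z < C x y" "z \<in> {0<..1}"
        using a False C_range[OF x y] by (auto simp: z_def)
      then have "g x + g y < g z"
        using g_C[OF x y] g_less[of z "C x y"] by auto
      from eventually_less_lim[OF sum conv[OF z(3)] this]
      show ?thesis
        by eventually_elim (use seq.C_ge_iff_g[OF xy z(3)] z in \<open>auto intro: less_le_trans\<close>)
    qed
  next
    fix a assume a: "C x y < a"
    show "\<forall>\<^sub>F n in sequentially. Cs n x y < a"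
    proof (cases "1 < a")
      case True
      then show ?thesis
        using seq.C_range[OF x y] by (intro always_eventually) (auto intro: le_less_trans)
    next
      case False
      define z where "z = (C x y + a) / 2"
      have z: "z < a" "C x y < z" "z \<in> {0<..1}"
        using a False C_range[OF x y] by (auto simp: z_def)
      then have "g z < g x + g y" using C_ge_iff_g[OF xy z(3)] by auto
      from eventually_less_lim[OF conv[OF z(3)] sum this]
      show ?thesis
      proof eventually_elim
        case (elim n)
        then have "\<not> z \<le> Cs n x y" using seq.C_ge_iff_g[OF xy z(3), of n] by auto
        then show ?case using z by auto
      qed
    qed
  qed
qed (use x y in auto)

text \<open>
  The argument moves with \<open>n\<close> because the kernels evaluate the derivative at \<open>C\<^sub>n x y\<close>.  A slope over a fixed interval close to \<open>x\<close> on either side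
  is eventually on the correct side of \<open>a\<close>, and by monotonicity it bounds the derivative at every point beyond the interval.
\<close>

lemma derivatives_tendsto:
  assumes x: "x \<in> cont_right_deriv \<phi>" and c: "c \<longlonglongrightarrow> x" "\<forall>\<^sub>F n in sequentially. 0 < c n \<and> c n < 1"
  shows "(\<lambda>n. Ds n (c n)) \<longlonglongrightarrow> D x"
proof (rule order_tendstoI)
  have x01: "0 < x" "x < 1" and lim: "(D \<longlongrightarrow> D x) (at x)"
    using x by (auto simp: cont_right_deriv_def isCont_def)
  fix a assume a: "a < D x"
  have "\<forall>\<^sub>F z in at_left x. a < D z"
    using order_tendstoD(1)[OF lim a] by (rule filter_leD[rotated]) (simp add: at_le)
  moreover have "\<forall>\<^sub>F z in at_left x. z \<in> {0<..<x}"
    using x01 by (intro eventually_at_left_real)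
  ultimately have "\<forall>\<^sub>F z in at_left x. a < D z \<and> z \<in> {0<..<x}" by eventually_elim auto
  then obtain z where z: "a < D z" "0 < z" "z < x"
    using eventually_happens' trivial_limit_at_left_real by fastforce
  define w where "w = (z + x) / 2"
  have w: "z < w" "w < x" using z by (auto simp: w_def)
  have "a < (g w - g z) / (w - z)" using D_le_slope[of z w] z w x01 by auto
  moreover have "(\<lambda>n. (gs n w - gs n z) / (w - z)) \<longlonglongrightarrow> (g w - g z) / (w - z)"
    using z w x01 by (intro tendsto_intros conv) auto
  ultimately have "\<forall>\<^sub>F n in sequentially. a < (gs n w - gs n z) / (w - z)"
    by (rule order_tendstoD(1)[rotated])
  moreover have "\<forall>\<^sub>F n in sequentially. w < c n" using order_tendstoD(1)[OF c(1) w(2)] .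
  ultimately show "\<forall>\<^sub>F n in sequentially. a < Ds n (c n)" using c(2)
  proof eventually_elim
    case (elim n)
    have "(gs n w - gs n z) / (w - z) \<le> Ds n w" using seq.slope_le_D[of z w n] z w x01 by auto
    also have "\<dots> \<le> Ds n (c n)" using seq.D_mono[of w "c n" n] elim z w by auto
    finally show ?case using elim by auto
  qed
next
  have x01: "0 < x" "x < 1"
    using x by (auto simp: cont_right_deriv_def)
  fix a assume a: "D x < a"
  have "\<forall>\<^sub>F z in at_right x. D z < a" using order_tendstoD(2)[OF D_right_cont[OF x01] a] .
  moreover have "\<forall>\<^sub>F z in at_right x. x < z \<and> z < 1"
    using x01 by (intro eventually_at_right_between)
  ultimately have "\<forall>\<^sub>F z in at_right x. D z < a \<and> x < z \<and> z < 1" by eventually_elim auto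
  then obtain z where z: "D z < a" "x < z" "z < 1"
    using eventually_happens' trivial_limit_at_right_real by blast
  define w where "w = (z + x) / 2"
  have w: "w < z" "x < w" using z by (auto simp: w_def)
  have "(g z - g w) / (z - w) < a" using slope_le_D[of w z] z w x01 by auto
  moreover have "(\<lambda>n. (gs n z - gs n w) / (z - w)) \<longlonglongrightarrow> (g z - g w) / (z - w)"
    using z w x01 by (intro tendsto_intros conv) auto
  ultimately have "\<forall>\<^sub>F n in sequentially. (gs n z - gs n w) / (z - w) < a"
    by (rule order_tendstoD(2)[rotated])
  moreover have "\<forall>\<^sub>F n in sequentially. c n < w" using order_tendstoD(2)[OF c(1) w(2)] .
  ultimately show "\<forall>\<^sub>F n in sequentially. Ds n (c n) < a" using c(2)
  proof eventually_elim
    case (elim n)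
    have "Ds n (c n) \<le> Ds n w" using seq.D_mono[of "c n" w n] elim z w by auto
    also have "\<dots> \<le> (gs n z - gs n w) / (z - w)" using seq.D_le_slope[of w z n] z w x01 by auto
    finally show ?case using elim by auto
  qed
qed

lemma derivatives_tendsto_const: "x \<in> cont_right_deriv \<phi> \<Longrightarrow> (\<lambda>n. Ds n x) \<longlonglongrightarrow> D x"
  by (rule derivatives_tendsto) (auto simp: cont_right_deriv_def)

lemma kendall_tendsto:
  assumes x: "x \<in> cont_right_deriv \<phi>"
  shows "(\<lambda>n. kendall_formula (\<phi>s n) x) \<longlonglongrightarrow> kendall_formula \<phi> x"
proof -
  have "0 < x" "x < 1" using x by (auto simp: cont_right_deriv_def)
  then show ?thesis
    unfolding kendall_formula_def using D_neg[of x]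
    by (intro tendsto_intros conv derivatives_tendsto_const x) auto
qed

lemma kernels_tendsto_pos:
  assumes x: "x \<in> cont_right_deriv \<phi>" and y: "y \<in> {0..1}"
    and C: "0 < C x y" "C x y \<in> cont_right_deriv \<phi>"
  shows "(\<lambda>n. ks n x y) \<longlonglongrightarrow> k x y"
proof -
  have x01: "x \<in> {0<..<1}" using x by (auto simp: cont_right_deriv_def)
  then have lim: "(\<lambda>n. Cs n x y) \<longlonglongrightarrow> C x y" using y by (intro copulas_tendsto) auto
  have ev: "\<forall>\<^sub>F n in sequentially. 0 < Cs n x y" using order_tendstoD(1)[OF lim C(1)] .
  have "(\<lambda>n. Ds n (Cs n x y)) \<longlonglongrightarrow> D (C x y)"
  proof (rule derivatives_tendsto[OF C(2) lim])
    show "\<forall>\<^sub>F n in sequentially. 0 < Cs n x y \<and> Cs n x y < 1"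
      using ev by eventually_elim (use seq.k_pos[of x y] x01 y in auto)
  qed
  then have "(\<lambda>n. Ds n x / Ds n (Cs n x y)) \<longlonglongrightarrow> D x / D (C x y)"
    using k_pos[OF x01 y C(1)] by (intro tendsto_divide derivatives_tendsto_const x) auto
  moreover have "\<forall>\<^sub>F n in sequentially. Ds n x / Ds n (Cs n x y) = ks n x y"
    using ev by eventually_elim (use seq.k_pos[of x y] x01 y in auto)
  ultimately show ?thesis
    using k_pos[OF x01 y C(1)] by (simp add: Lim_transform_eventually)
qed

text \<open>
  Where the limit copula vanishes even a little to the right of \<open>x\<close>, the kernels tend to \<open>0\<close>.  The generator falls between \<open>C\<^sub>n x y\<close> and
  \<open>C\<^sub>n x' y\<close> by \<open>g\<^sub>n x - g\<^sub>n x'\<close>, which stays away from \<open>0\<close>, while these two numbers both tend to \<open>0\<close>; so the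
  derivative at \<open>C\<^sub>n x y\<close>, if this is positive, tends to \<open>-\<infinity>\<close>.
  This covers a finite and an infinite limit of the derivative at \<open>0\<close> alike.
\<close>

lemma kernels_tendsto_zero:
  assumes x: "x \<in> cont_right_deriv \<phi>" and y: "y \<in> {0..1}"
    and x': "x < x'" "x' \<le> 1" and C: "C x' y = 0"
  shows "(\<lambda>n. ks n x y) \<longlonglongrightarrow> k x y"
proof -
  have x01: "x \<in> {0<..<1}" using x by (auto simp: cont_right_deriv_def)
  have "C x y \<le> 0" using C_mono[of x y x' y] C x01 y x' by auto
  then have "k x y = 0" using x01 by (auto simp: arch_kernel_def)
  define B where "B n = \<bar>Ds n x\<bar> * Cs n x' y / (gs n x - gs n x')" for n
  have "B \<longlonglongrightarrow> \<bar>D x\<bar> * C x' y / (g x - g x')"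
    unfolding B_def using x01 x' y g_less[of x x']
    by (intro tendsto_intros derivatives_tendsto_const[OF x] copulas_tendsto conv) auto
  then have "B \<longlonglongrightarrow> 0" using C by simp
  have "0 \<le> ks n x y \<and> ks n x y \<le> B n" for n
  proof -
    have gs: "gs n x' < gs n x" using seq.g_less[of x x' n] x01 x' by auto
    have C': "0 \<le> Cs n x' y" using seq.C_range[of x' y n] x01 x' y by auto
    show ?thesis
    proof (cases "0 < Cs n x y")
      case True
      let ?c = "Cs n x y" and ?c' = "Cs n x' y"
      have c: "?c < ?c'" using seq.C_less_left[of x x' y n] True x01 x' y by auto
      have kp: "ks n x y = Ds n x / Ds n ?c" "Ds n x < 0" "Ds n ?c < 0" "?c < 1"
        using seq.k_pos[of x y n] x01 y True by auto
      have "Ds n ?c \<le> (gs n ?c' - gs n ?c) / (?c' - ?c)"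
        using seq.D_le_slope[of ?c ?c' n] c True seq.C_range[of x' y n] x01 x' y by auto
      also have "gs n ?c' - gs n ?c = gs n x' - gs n x"
        using seq.g_C[of x y n] seq.g_C[of x' y n] True c x01 x' y by auto
      finally have "(gs n x - gs n x') / (?c' - ?c) \<le> - Ds n ?c"
        using minus_divide_left[of "gs n x - gs n x'" "?c' - ?c"] by simp
      moreover have "(gs n x - gs n x') / ?c' \<le> (gs n x - gs n x') / (?c' - ?c)"
        using gs c True by (intro divide_left_mono) auto
      ultimately have "(gs n x - gs n x') / ?c' \<le> - Ds n ?c" by simp
      then have "gs n x - gs n x' \<le> - Ds n ?c * ?c'" using c True by (simp add: divide_le_eq)
      then have "(- Ds n x) / (- Ds n ?c) \<le> (- Ds n x) * ?c' / (gs n x - gs n x')"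
        using kp gs by (intro divide_le_divide_of_le_mult) auto
      then show ?thesis
        using kp seq.k_range[OF y, of n x] by (simp add: B_def)
    next
      case False
      then have "ks n x y = 0" using x01 by (auto simp: arch_kernel_def)
      then show ?thesis using gs C' by (simp add: B_def)
    qed
  qed
  then show ?thesis
    using tendsto_sandwich[OF _ _ tendsto_const \<open>B \<longlonglongrightarrow> 0\<close>, of "\<lambda>n. ks n x y"] \<open>k x y = 0\<close> by simp
qed

text \<open>
  The exceptions are the discontinuities of \<open>D\<close>, their preimages under the strictly increasing part of \<open>C\<close> in its first variable, and the
  largest zero of \<open>C\<close>.
\<close>

lemma kernels_tendsto_ae:
  assumes y: "y \<in> {0..1}"
  obtains N where "countable N" "\<And>x. x \<in> {0<..<1} - N \<Longrightarrow> (\<lambda>n. ks n x y) \<longlonglongrightarrow> k x y"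
proof -
  let ?d = "{0<..<1} - cont_right_deriv \<phi>"
  define N1 where "N1 = {x \<in> {0<..<1}. 0 < C x y \<and> C x y \<in> ?d}"
  define N2 where "N2 = {x \<in> {0<..<1}. C x y = 0 \<and> (\<forall>x'\<in>{x<..1}. 0 < C x' y)}"
  have "inj_on (\<lambda>x. C x y) N1"
  proof (rule inj_onI)
    fix u v assume "u \<in> N1" "v \<in> N1" "C u y = C v y"
    then show "u = v"
      using C_less_left[of u v y] C_less_left[of v u y] y
      by (cases u v rule: linorder_cases) (auto simp: N1_def)
  qed
  moreover have "countable ((\<lambda>x. C x y) ` N1)"
    by (rule countable_subset[OF _ discont_D_countable]) (auto simp: N1_def)
  ultimately have "countable N1" by (rule countable_image_inj_on[rotated])
  moreover have "countable N2"
    unfolding N2_def using finite_last_zeros by (rule countable_finite)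
  ultimately have "countable (?d \<union> N1 \<union> N2)" using discont_D_countable by simp
  moreover have "(\<lambda>n. ks n x y) \<longlonglongrightarrow> k x y" if x: "x \<in> {0<..<1} - (?d \<union> N1 \<union> N2)" for x
  proof (cases "0 < C x y")
    case True
    then show ?thesis
      using x k_pos[of x y] y by (intro kernels_tendsto_pos) (auto simp: N1_def)
  next
    case False
    then have "C x y = 0" using C_range[of x y] x y by auto
    then obtain x' where "x < x'" "x' \<le> 1" "\<not> 0 < C x' y" using x by (auto simp: N2_def)
    then show ?thesis
      using x y C_range[of x' y] by (intro kernels_tendsto_zero[of x y x']) auto
  qed
  ultimately show ?thesis by (rule that)
qed

end

end

section \<open>The selected Markov kernel and the Kendall distribution function\<close>

lemma clamp_contract: "\<bar>min (max x 0) 1 - min (max y 0) 1\<bar> \<le> \<bar>x - y\<bar>" for x y :: real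
  by (simp add: min_def max_def abs_if)

text \<open>
  By monotonicity \<open>Fs n y\<close> is squeezed between values at rational numbers close to \<open>y\<close> on either side.
\<close>

lemma tendsto_of_dense:
  fixes F :: "real \<Rightarrow> real" and Fs :: "nat \<Rightarrow> real \<Rightarrow> real"
  assumes mono: "\<And>n. mono (Fs n)"
    and conv: "\<And>q. q \<in> \<rat> \<Longrightarrow> (\<lambda>n. Fs n q) \<longlonglongrightarrow> F q"
    and cont: "isCont F y"
  shows "(\<lambda>n. Fs n y) \<longlonglongrightarrow> F y"
proof (rule order_tendstoI)
  have lim: "(F \<longlongrightarrow> F y) (at y)" using cont by (simp add: isCont_def)
  fix a assume a: "a < F y"
  have "\<forall>\<^sub>F z in at_left y. a < F z"
    using order_tendstoD(1)[OF lim a] by (rule filter_leD[rotated]) (simp add: at_le)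
  then obtain b where b: "b < y" "\<And>z. b < z \<Longrightarrow> z < y \<Longrightarrow> a < F z"
    using eventually_at_left[of "y - 1" y] by auto
  obtain q where q: "q \<in> \<rat>" "b < q" "q < y" using Rats_dense_in_real[OF b(1)] by blast
  have "\<forall>\<^sub>F n in sequentially. a < Fs n q" using order_tendstoD(1)[OF conv[OF q(1)] b(2)[OF q(2,3)]] .
  then show "\<forall>\<^sub>F n in sequentially. a < Fs n y"
    by eventually_elim (use monoD[OF mono, of q y] q in \<open>auto intro: less_le_trans\<close>)
next
  have lim: "(F \<longlongrightarrow> F y) (at y)" using cont by (simp add: isCont_def)
  fix a assume a: "F y < a"
  have "\<forall>\<^sub>F z in at_right y. F z < a"
    using order_tendstoD(2)[OF lim a] by (rule filter_leD[rotated]) (simp add: at_le)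
  then obtain b where b: "y < b" "\<And>z. y < z \<Longrightarrow> z < b \<Longrightarrow> F z < a"
    using eventually_at_right[of y "y + 1"] by auto
  obtain q where q: "q \<in> \<rat>" "y < q" "q < b" using Rats_dense_in_real[OF b(1)] by blast
  have "\<forall>\<^sub>F n in sequentially. Fs n q < a" using order_tendstoD(2)[OF conv[OF q(1)] b(2)[OF q(2,3)]] .
  then show "\<forall>\<^sub>F n in sequentially. Fs n y < a"
    by eventually_elim (use monoD[OF mono, of y q] q in \<open>auto intro: le_less_trans\<close>)
qed

text \<open>
  Around \<open>y\<close> the function stays above half its value at \<open>y\<close> on an interval of length \<open>f y / 4\<close> inside \<open>[0,1]\<close>, so its integral is at
  least \<open>(f y)\<^sup>2 / 8\<close>.
\<close>

lemma lipschitz_le_sqrt_integral: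
  fixes f :: "real \<Rightarrow> real"
  assumes lip: "2-lipschitz_on {0..1} f" and range: "\<And>x. x \<in> {0..1} \<Longrightarrow> f x \<in> {0..1}"
    and y: "y \<in> {0..1}"
  shows "f y \<le> sqrt (8 * (\<integral>x. f x \<partial>unit_lebesgue))"
proof (rule real_le_rsqrt)
  define e where "e = f y"
  have e: "0 \<le> e" "e \<le> 1" using range[OF y] by (auto simp: e_def)
  obtain a where a: "{a..a + e/4} \<subseteq> {0..1}" "y \<in> {a, a + e/4}"
  proof (cases "y \<le> 1/2")
    case True
    then show ?thesis using that[of y] e y by auto
  next
    case False
    then show ?thesis using that[of "y - e/4"] e y by auto
  qed
  let ?J = "{a..a + e/4}"
  have J [measurable]: "?J \<in> sets unit_borel" using a by (simp add: sets_unit_borel_iff)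
  have [measurable]: "f \<in> borel_measurable unit_lebesgue"
    using borel_measurable_continuous_on_restrict[OF lipschitz_on_continuous_on[OF lip]]
    unfolding unit_borel_def[symmetric] by (simp cong: measurable_cong_sets)
  have int: "integrable unit_lebesgue f"
  proof (rule unit.integrable_const_bound[of _ 1])
    show "AE x in unit_lebesgue. norm (f x) \<le> 1"
      by (rule AE_I2) (use range in simp)
  qed simp
  have "measure unit_lebesgue (?J \<inter> space unit_lebesgue) = e / 4"
    using a(1) e by (simp add: measure_def emeasure_unit_lebesgue Int_absorb2 del: Int_atLeastAtMost)
  then have "e / 2 * (e / 4) = (\<integral>x. e / 2 * indicator ?J x \<partial>unit_lebesgue)"
    by (simp del: space_unit_lebesgue Int_atLeastAtMost)
  also have "\<dots> \<le> (\<integral>x. f x \<partial>unit_lebesgue)"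
  proof (rule integral_mono[OF _ int])
    show "integrable unit_lebesgue (\<lambda>x. e / 2 * indicator ?J x)"
      by (intro integrable_mult_right integrable_real_indicator)
        (auto simp: less_top[symmetric] unit.emeasure_finite)
    fix x assume x: "x \<in> space unit_lebesgue"
    show "e / 2 * indicator ?J x \<le> f x"
    proof (cases "x \<in> ?J")
      case True
      then have "dist y x \<le> e / 4" using a(2) by (auto simp: dist_real_def)
      then have "\<bar>f y - f x\<bar> \<le> e / 2"
        using lipschitz_onD[OF lip y, of x] x by (auto simp: dist_real_def)
      then have "e / 2 \<le> f x" unfolding e_def by linarith
      then show ?thesis using True by simp
    qed (use range x in auto)
  qed
  finally show "(f y)\<^sup>2 \<le> 8 * (\<integral>x. f x \<partial>unit_lebesgue)"
    by (simp add: e_def power2_eq_square)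
qed

context archimedean_generator
begin

sublocale cop: conditional_cdf C k
  by unfold_locales (use k_range k_1 k_mono k_measurable k_has_integral C_cont_right in auto)

abbreviation M :: "real \<Rightarrow> real measure" where "M \<equiv> markov_kernel C"

lemma M_kernel: "M \<in> unit_borel \<rightarrow>\<^sub>M prob_algebra unit_borel"
  using cop.markov_kernel by (simp add: is_markov_kernel_def)

lemma M_prob_space: "t \<in> {0..1} \<Longrightarrow> prob_space (M t)" "t \<in> {0..1} \<Longrightarrow> sets (M t) = sets unit_borel"
  using measurable_space[OF M_kernel, of t] by (auto simp: space_prob_algebra)

lemma M_total: "t \<in> {0..1} \<Longrightarrow> measure (M t) {0..1} = 1"
  using prob_space.prob_space[OF M_prob_space(1)] sets_eq_imp_space_eq[OF M_prob_space(2)] by simp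

lemma M_cdf_measurable:
  assumes "y \<in> {0..1}"
  shows "(\<lambda>t. measure (M t) {0..y}) \<in> borel_measurable unit_lebesgue"
  using measurable_compose[OF M_kernel measurable_measure_prob_algebra[of "{0..y}"]] assms
  by (simp cong: measurable_cong_sets)

text \<open>
  The second marginal of the law is uniform, so it gives no mass to \<open>{y}\<close>.
\<close>

lemma M_no_atom:
  assumes y: "y \<in> {0..1}"
  shows "AE t in unit_lebesgue. measure (M t) {y} = 0"
proof -
  interpret law: prob_space cop.law by (rule cop.law_prob_space)
  have S [measurable]: "{y} \<in> sets unit_borel" using y by (simp add: sets_unit_borel_iff)
  have "distr cop.law unit_borel snd = unit_lebesgue"
  proof (rule unit_measure_eqI)
    show "finite_measure (distr cop.law unit_borel snd)"
      by (rule law.finite_measure_distr) measurable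
    fix x :: real assume x: "x \<in> {0..1}"
    have "emeasure (distr cop.law unit_borel snd) {0..x} = emeasure cop.law ({0..1} \<times> {0..x})"
      using x by (subst emeasure_distr) (auto simp: space_pair_measure intro!: arg_cong2[where f = emeasure]
        simp: sets_eq_imp_space_eq[OF cop.sets_law])
    also have "\<dots> = emeasure unit_lebesgue {0..x}"
      using x cop.law_cdf[of 1 x] by (simp add: emeasure_unit_lebesgue)
    finally show "emeasure (distr cop.law unit_borel snd) {0..x} = emeasure unit_lebesgue {0..x}" .
  qed auto
  then have "0 = emeasure (distr cop.law unit_borel snd) {y}"
    using y by (simp add: emeasure_unit_lebesgue)
  also have "\<dots> = emeasure cop.law ({0..1} \<times> {y})"
    using y by (subst emeasure_distr) (auto simp: space_pair_measure intro!: arg_cong2[where f = emeasure]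
      simp: sets_eq_imp_space_eq[OF cop.sets_law])
  also have "\<dots> = (\<integral>\<^sup>+t\<in>{0..1}. emeasure (M t) {y} \<partial>unit_lebesgue)"
    using cop.markov_kernel S unfolding is_markov_kernel_def cop.copula_law_eq by auto
  also have "\<dots> = (\<integral>\<^sup>+t. emeasure (M t) {y} \<partial>unit_lebesgue)"
    by (rule nn_integral_cong) auto
  finally have "(\<integral>\<^sup>+t. emeasure (M t) {y} \<partial>unit_lebesgue) = 0" by simp
  moreover have "(\<lambda>t. emeasure (M t) {y}) \<in> borel_measurable unit_lebesgue"
    using measurable_emeasure_kernel[OF measurable_prob_algebraD[OF M_kernel] S]
    by (simp cong: measurable_cong_sets)
  ultimately have "AE t in unit_lebesgue. emeasure (M t) {y} = 0"
    by (simp add: nn_integral_0_iff_AE)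
  then show ?thesis by eventually_elim (simp add: measure_def)
qed

lemma M_real_distribution: "t \<in> {0..1} \<Longrightarrow> real_distribution (distr (M t) borel (\<lambda>y. y))"
proof -
  assume t: "t \<in> {0..1}"
  interpret prob_space "M t" using M_prob_space t by simp
  show ?thesis
    using M_prob_space(2)[OF t]
    by (intro real_distribution_distr) (simp cong: measurable_cong_sets)
qed

lemma cdf_M:
  assumes t: "t \<in> {0..1}"
  shows "cdf (distr (M t) borel (\<lambda>y. y)) y = (if y < 0 then 0 else measure (M t) {0..min y 1})"
proof -
  note s = M_prob_space(2)[OF t] sets_eq_imp_space_eq[OF M_prob_space(2)[OF t]]
  have "cdf (distr (M t) borel (\<lambda>y. y)) y = measure (M t) ({..y} \<inter> {0..1})"
    unfolding cdf_def using s by (subst measure_distr) (auto cong: measurable_cong_sets)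
  also have "{..y} \<inter> {0..1} = (if y < 0 then {} else {0..min y 1})" by auto
  finally show ?thesis by simp
qed

lemma measure_singleton_M: "t \<in> {0..1} \<Longrightarrow> y \<in> {0..1} \<Longrightarrow> measure (distr (M t) borel (\<lambda>y. y)) {y} = measure (M t) {y}"
proof -
  assume t: "t \<in> {0..1}" "y \<in> {0..1}"
  note s = M_prob_space(2)[OF t(1)] sets_eq_imp_space_eq[OF M_prob_space(2)[OF t(1)]]
  show ?thesis
    using s t by (subst measure_distr) (auto cong: measurable_cong_sets)
qed

lemma has_bochner_integral_k:
  assumes x: "x \<in> {0..1}" and y: "y \<in> {0..1}"
  shows "has_bochner_integral unit_lebesgue (\<lambda>t. k t y * indicator {0..x} t) (C x y)"
proof (rule has_bochner_integral_nn_integral)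
  have [measurable]: "(\<lambda>t. k t y) \<in> borel_measurable unit_lebesgue"
    using k_measurable[OF y] by (simp cong: measurable_cong_sets)
  have [measurable]: "{0..x} \<in> sets unit_borel" using x by simp
  show "(\<lambda>t. k t y * indicator {0..x} t) \<in> borel_measurable unit_lebesgue" by measurable
  show "AE t in unit_lebesgue. 0 \<le> k t y * indicator {0..x} t"
    using k_range[OF y] by (auto intro!: AE_I2)
  show "0 \<le> C x y" using C_range[OF x y] by simp
  have "(\<integral>\<^sup>+t. ennreal (k t y * indicator {0..x} t) \<partial>unit_lebesgue) =
    (\<integral>\<^sup>+t\<in>{0..x}. ennreal (k t y) \<partial>unit_lebesgue)"
    by (rule nn_integral_cong) (auto simp: indicator_def)
  then show "(\<integral>\<^sup>+t. ennreal (k t y * indicator {0..x} t) \<partial>unit_lebesgue) = ennreal (C x y)"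
    using cop.nn_integral_k[OF x y] by simp
qed

lemma has_bochner_integral_k_1:
  assumes y: "y \<in> {0..1}"
  shows "has_bochner_integral unit_lebesgue (\<lambda>t. k t y) y"
proof -
  have "has_bochner_integral unit_lebesgue (\<lambda>t. k t y * indicator {0..1} t) y"
    using has_bochner_integral_k[of 1 y] y by simp
  moreover have "has_bochner_integral unit_lebesgue (\<lambda>t. k t y * indicator {0..1} t) y \<longleftrightarrow>
      has_bochner_integral unit_lebesgue (\<lambda>t. k t y) y"
    by (rule has_bochner_integral_cong) auto
  ultimately show ?thesis by simp
qed

text \<open>
  Clamping the arguments extends \<open>C\<close> to a Lipschitz function on the plane.
\<close>

lemma C_measurable: "(\<lambda>(x, y). C x y) \<in> borel_measurable (unit_borel \<Otimes>\<^sub>M unit_borel)"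
proof -
  let ?c = "\<lambda>x. min (max x 0) (1::real)"
  have lip: "\<bar>C (?c x) (?c y) - C (?c x') (?c y')\<bar> \<le> \<bar>x - x'\<bar> + \<bar>y - y'\<bar>" for x y x' y'
  proof -
    have "\<bar>C (?c x) (?c y) - C (?c x') (?c y)\<bar> \<le> \<bar>?c x - ?c x'\<bar>"
      using lipschitz_onD[OF C_lipschitz, of "?c y" "?c x" "?c x'"] by (simp add: dist_real_def)
    also note clamp_contract
    finally have 1: "\<bar>C (?c x) (?c y) - C (?c x') (?c y)\<bar> \<le> \<bar>x - x'\<bar>" .
    have "\<bar>C (?c x') (?c y) - C (?c x') (?c y')\<bar> \<le> \<bar>?c y - ?c y'\<bar>"
      using lipschitz_onD[OF C_lipschitz, of "?c x'" "?c y" "?c y'"]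
      by (simp add: dist_real_def C_comm[of "?c x'"])
    also note clamp_contract
    finally have 2: "\<bar>C (?c x') (?c y) - C (?c x') (?c y')\<bar> \<le> \<bar>y - y'\<bar>" .
    show ?thesis
      using abs_triangle_ineq[of "C (?c x) (?c y) - C (?c x') (?c y)" "C (?c x') (?c y) - C (?c x') (?c y')"]
        add_mono[OF 1 2] by simp
  qed
  have "2-lipschitz_on UNIV (\<lambda>p. C (?c (fst p)) (?c (snd p)))"
  proof (rule lipschitz_onI)
    fix p q :: "real \<times> real"
    have "\<bar>fst p - fst q\<bar> \<le> dist p q" "\<bar>snd p - snd q\<bar> \<le> dist p q"
      using dist_fst_le[of p q] dist_snd_le[of p q] by (auto simp: dist_real_def)
    then have "\<bar>fst p - fst q\<bar> + \<bar>snd p - snd q\<bar> \<le> 2 * dist p q" by simp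
    with lip[of "fst p" "snd p" "fst q" "snd q"]
    show "dist (C (?c (fst p)) (?c (snd p))) (C (?c (fst q)) (?c (snd q))) \<le> 2 * dist p q"
      unfolding dist_real_def by (rule order_trans)
  qed simp
  then have "(\<lambda>p. C (?c (fst p)) (?c (snd p))) \<in> borel_measurable borel"
    by (intro borel_measurable_continuous_onI lipschitz_on_continuous_on)
  then have meas: "(\<lambda>p. C (?c (fst p)) (?c (snd p))) \<in> borel_measurable (borel \<Otimes>\<^sub>M borel)"
    by (simp only: borel_prod)
  have incl: "(\<lambda>p. (fst p, snd p)) \<in> unit_borel \<Otimes>\<^sub>M unit_borel \<rightarrow>\<^sub>M borel \<Otimes>\<^sub>M borel"
    by (intro measurable_Pair measurable_compose[OF measurable_fst unit_borel_inclusion]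
        measurable_compose[OF measurable_snd unit_borel_inclusion])
  have "(\<lambda>p. C (?c (fst p)) (?c (snd p))) \<in> borel_measurable (unit_borel \<Otimes>\<^sub>M unit_borel)"
    using measurable_compose[OF incl meas] by (simp only: fst_conv snd_conv)
  moreover have "C (?c (fst p)) (?c (snd p)) = (case p of (x, y) \<Rightarrow> C x y)"
    if "p \<in> space (unit_borel \<Otimes>\<^sub>M unit_borel)" for p
    using that by (cases p) (simp add: space_pair_measure max_absorb1 min_absorb1)
  ultimately show ?thesis by (subst (asm) measurable_cong) simp_all
qed

text \<open>
  The section is an interval \<open>{0..b}\<close> with \<open>C t b = x\<close>.  At this \<open>b\<close> the function \<open>k t\<close> is right-continuous, because \<open>D\<close> is right-continuous and
  \<open>C t\<close> increases strictly; hence \<open>K t\<close> gives \<open>{0..b}\<close> the mass \<open>k t b\<close>.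
\<close>

lemma K_level_set:
  assumes x: "0 < x" "x < t" and t: "t < 1"
  shows "emeasure (cop.K t) {y \<in> {0..1}. C t y \<le> x} = ennreal (D t / D x)"
proof -
  have tx: "t \<in> {0..1}" "t \<in> {0<..1}" "x \<in> {0<..1}" "t \<in> {0<..<1}" using x t by auto
  have gtx: "g t < g x" using g_less x t by simp
  have "ennreal (g x - g t) < \<phi> 0"
    by (rule order_le_less_trans[OF ennreal_leI g_less_phi_0[of x]]) (use x t in auto)
  then obtain b where b: "b \<in> {0<..1}" "g b = g x - g t"
    using g_surj[of "g x - g t"] gtx by auto
  have b1: "b < 1" using b gtx by (cases "b = 1") auto
  have ge: "x \<le> C t b" using C_ge_iff_g[OF tx(2) b(1) tx(3)] b by simp
  have "g (C t b) = g x" using g_C[of t b] ge x tx b by auto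
  then have Cb: "C t b = x"
    using ge g_less[of x "C t b"] x g_C(4)[of t b] tx b by (cases "x = C t b") auto
  have less: "x < C t y" if "b < y" "y \<le> 1" for y
    using C_less_left[of b y t] that b Cb x tx by (auto simp: C_comm[of t])
  have "{y \<in> {0..1}. C t y \<le> x} = {0..b}"
  proof (intro equalityI subsetI)
    fix y assume "y \<in> {y \<in> {0..1}. C t y \<le> x}"
    then show "y \<in> {0..b}" using less[of y] by force
  next
    fix y assume "y \<in> {0..b}"
    then show "y \<in> {y \<in> {0..1}. C t y \<le> x}" using C_mono[of t y t b] Cb tx b b1 by auto
  qed
  moreover have "emeasure (cop.K t) {0..b} = ennreal (k t b)"
  proof (rule antisym)
    show "ennreal (k t b) \<le> emeasure (cop.K t) {0..b}"
      using cop.K_ge[of t b] tx b by auto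
    have lim: "(C t \<longlongrightarrow> C t b) (at_right b)"
      by (rule tendsto_at_right_unit[OF C_cont_right[OF tx(1)]]) (use b b1 in auto)
    have ev: "\<forall>\<^sub>F y in at_right b. b < y \<and> y < 1"
      by (rule eventually_at_right_between[OF b1])
    have right: "filterlim (C t) (at_right x) (at_right b)"
    proof (rule tendsto_imp_filterlim_at_right)
      show "(C t \<longlongrightarrow> x) (at_right b)" using lim Cb by simp
      show "\<forall>\<^sub>F y in at_right b. x < C t y"
        using ev by eventually_elim (use less in auto)
    qed
    have "((\<lambda>y. D (C t y)) \<longlongrightarrow> D x) (at_right b)"
      by (rule filterlim_compose[OF D_right_cont right]) (use x t in auto)
    then have "((\<lambda>y. D t / D (C t y)) \<longlongrightarrow> D t / D x) (at_right b)"
      using D_neg[of x] x t by (intro tendsto_intros) auto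
    moreover have "k t b = D t / D x"
      using k_pos[of t b] Cb x tx b by auto
    ultimately have "((\<lambda>y. ennreal (D t / D (C t y))) \<longlongrightarrow> ennreal (k t b)) (at_right b)"
      by (simp add: tendsto_ennrealI)
    then show "emeasure (cop.K t) {0..b} \<le> ennreal (k t b)"
    proof (rule tendsto_lowerbound)
      show "\<forall>\<^sub>F y in at_right b. emeasure (cop.K t) {0..b} \<le> ennreal (D t / D (C t y))"
        using ev
      proof eventually_elim
        case (elim y)
        have "k t y = D t / D (C t y)" using k_pos[of t y] less[of y] elim x tx b by auto
        then show ?case using cop.K_le[of t b y] elim tx b by auto
      qed
    qed simp
  qed
  moreover have "k t b = D t / D x" using k_pos[of t b] Cb x tx b by auto
  ultimately show ?thesis by simp
qed

text \<open>
  Given \<open>X = t\<close>, the event \<open>C X Y \<le> x\<close> is certain for \<open>t \<le> x\<close> and has probability \<open>D t / D x\<close> for \<open>t > x\<close>; integrating the latter over \<open>[x,1]\<close>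
  gives \<open>(g 1 - g x) / D x\<close>.
\<close>

lemma kendall_cdf_eq:
  assumes x: "0 < x" "x < 1"
  shows "kendall_cdf C x = kendall_formula \<phi> x"
proof -
  note [measurable] = C_measurable
  define A where "A = {p \<in> {0..1} \<times> {0..1}. C (fst p) (snd p) \<le> x}"
  have A_eq: "A = {p \<in> space (unit_borel \<Otimes>\<^sub>M unit_borel). (case p of (x, y) \<Rightarrow> C x y) \<le> x}"
    by (auto simp: A_def space_pair_measure)
  have A [measurable]: "A \<in> sets (unit_borel \<Otimes>\<^sub>M unit_borel)"
    unfolding A_eq by measurable
  define H where "H t = (if t \<le> x then 1 else if t < 1 then D t / D x else 0)" for t
  have H0: "0 \<le> H t" for t
    using D_neg[of t] D_neg[of x] x by (auto simp: H_def divide_nonpos_neg)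
  have "(H has_integral x) {0..x}"
    using has_integral_const_real[of "1::real" 0 x] x
    by (subst has_integral_cong[of _ _ "\<lambda>_. 1"]) (auto simp: H_def)
  moreover have "(H has_integral (g 1 - g x) / D x) {x..1}"
  proof (rule has_integral_spike_finite[of "{x, 1}"])
    show "((\<lambda>t. D t / D x) has_integral (g 1 - g x) / D x) {x..1}"
      using has_integral_divide[OF D_has_integral[of x 1]] x by auto
  qed (use x in \<open>auto simp: H_def\<close>)
  ultimately have "(H has_integral x + (g 1 - g x) / D x) {0..1}"
    by (rule has_integral_combine[rotated 2]) (use x in auto)
  then have H: "(H has_integral kendall_formula \<phi> x) {0..1}"
    by (simp add: kendall_formula_def)
  have "emeasure cop.law A = (\<integral>\<^sup>+t. emeasure (cop.K t) (Pair t -` A) \<partial>unit_lebesgue)"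
    by (rule cop.emeasure_law[OF A])
  also have "\<dots> = (\<integral>\<^sup>+t. ennreal (H t) \<partial>unit_lebesgue)"
  proof (rule nn_integral_cong_AE, rule AE_unit_countable[of "{}"])
    fix t :: real assume "t \<in> {0<..<1} - {}"
    then have t: "t \<in> {0<..<1}" by simp
    have sec: "Pair t -` A = {y \<in> {0..1}. C t y \<le> x}" using t by (auto simp: A_def)
    show "emeasure (cop.K t) (Pair t -` A) = ennreal (H t)"
    proof (cases "t \<le> x")
      case True
      then have "Pair t -` A = {0..1}" unfolding sec using C_le_left[of t] t by fastforce
      moreover have "prob_space (cop.K t)" "space (cop.K t) = {0..1}"
        using measurable_space[OF cop.K_prob_kernel, of t] t
        by (auto simp: space_prob_algebra cop.K_def)
      ultimately show ?thesis using True prob_space.emeasure_space_1[of "cop.K t"] by (simp add: H_def)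
    next
      case False
      then show ?thesis unfolding sec using K_level_set[of x t] x t by (simp add: H_def)
    qed
  qed simp
  also have "\<dots> = (\<integral>\<^sup>+t. ennreal (H t) * indicator {0..1} t \<partial>lborel)"
    by (rule nn_integral_unit_lebesgue)
  also have "\<dots> = ennreal (kendall_formula \<phi> x)"
    by (rule nn_integral_has_integral_lebesgue'[OF H0 H])
  finally have "measure cop.law A = kendall_formula \<phi> x"
    using has_integral_nonneg[OF H] H0 by (simp add: measure_def)
  moreover have "kendall_cdf C x = measure cop.law A"
    unfolding kendall_cdf_def cdf_def cop.copula_law_eq A_eq
    by (subst measure_distr)
      (auto cong: measurable_cong_sets simp: sets_eq_imp_space_eq[OF cop.sets_law] vimage_def
        C_measurable intro!: arg_cong2[where f = measure])
  ultimately show ?thesis by simp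
qed

end

section \<open>Convergence of the Markov kernels\<close>

context generator_sequence
begin

definition kernel_dist :: "nat \<Rightarrow> real \<Rightarrow> real" where
  "kernel_dist n y = (\<integral>x. \<bar>ks n x y - k x y\<bar> \<partial>unit_lebesgue)"

lemma kernel_diff_measurable:
  assumes y: "y \<in> {0..1}"
  shows "(\<lambda>x. ks n x y - k x y) \<in> borel_measurable unit_lebesgue"
  using borel_measurable_diff[OF seq.k_measurable[OF y, of n] k_measurable[OF y]]
  by (simp cong: measurable_cong_sets)

lemma kernel_diff_bound: "y \<in> {0..1} \<Longrightarrow> \<bar>ks n x y - k x y\<bar> \<le> 1"
  using seq.k_range[of y n x] k_range[of y x] by auto

lemma kernel_diff_integrable:
  assumes y: "y \<in> {0..1}"
  shows "integrable unit_lebesgue (\<lambda>x. \<bar>ks n x y - k x y\<bar>)"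
  using kernel_diff_measurable[OF y] kernel_diff_bound[OF y]
  by (intro unit.integrable_const_bound[of _ 1]) auto

lemma kernel_dist_range:
  assumes y: "y \<in> {0..1}"
  shows "kernel_dist n y \<in> {0..1}"
proof -
  have "kernel_dist n y \<le> (\<integral>x. 1 \<partial>unit_lebesgue)"
    unfolding kernel_dist_def
    using kernel_diff_integrable[OF y] kernel_diff_bound[OF y] by (intro integral_mono) auto
  then show ?thesis
    using unit.prob_space by (simp add: kernel_dist_def)
qed

text \<open>
  As \<open>k x\<close> is nondecreasing and integrates to \<open>C 1 y = y\<close> over \<open>x\<close> in \<open>[0,1]\<close>, it moves by \<open>y' - y\<close> in the mean when \<open>y\<close> moves to \<open>y'\<close>; the same holds for the
  \<open>n\<close>-th kernel.
\<close>

lemma kernel_dist_lipschitz: "2-lipschitz_on {0..1} (kernel_dist n)"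
proof (rule lipschitz_onI)
  have *: "\<bar>kernel_dist n y' - kernel_dist n y\<bar> \<le> 2 * (y' - y)"
    if y: "y \<in> {0..1}" "y' \<in> {0..1}" "y \<le> y'" for y y'
  proof -
    let ?r = "\<lambda>x. (ks n x y' - ks n x y) + (k x y' - k x y)"
    have hb: "has_bochner_integral unit_lebesgue ?r ((y' - y) + (y' - y))"
      by (intro has_bochner_integral_add has_bochner_integral_diff has_bochner_integral_k_1
          seq.has_bochner_integral_k_1 y)
    have "\<bar>kernel_dist n y' - kernel_dist n y\<bar> =
        \<bar>\<integral>x. \<bar>ks n x y' - k x y'\<bar> - \<bar>ks n x y - k x y\<bar> \<partial>unit_lebesgue\<bar>"
      unfolding kernel_dist_def using kernel_diff_integrable y by simp
    also have "\<dots> \<le> (\<integral>x. \<bar>\<bar>ks n x y' - k x y'\<bar> - \<bar>ks n x y - k x y\<bar>\<bar> \<partial>unit_lebesgue)"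
      by (rule integral_abs_bound)
    also have "\<dots> \<le> (\<integral>x. ?r x \<partial>unit_lebesgue)"
    proof (rule integral_mono)
      fix x show "\<bar>\<bar>ks n x y' - k x y'\<bar> - \<bar>ks n x y - k x y\<bar>\<bar> \<le> ?r x"
        using k_mono[OF y, of x] seq.k_mono[OF y, of n x] by (simp add: abs_if)
    qed (use kernel_diff_integrable y hb in \<open>auto simp: has_bochner_integral_iff\<close>)
    also have "\<dots> = 2 * (y' - y)"
      using hb by (simp add: has_bochner_integral_iff)
    finally show ?thesis .
  qed
  fix u v :: real assume "u \<in> {0..1}" "v \<in> {0..1}"
  then show "dist (kernel_dist n u) (kernel_dist n v) \<le> 2 * dist u v"
    using *[of u v] *[of v u] by (cases "u \<le> v") (auto simp: dist_real_def abs_minus_commute)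
qed simp

lemma kernel_dist_measurable: "kernel_dist n \<in> borel_measurable unit_lebesgue"
  using borel_measurable_continuous_on_restrict[OF lipschitz_on_continuous_on[OF kernel_dist_lipschitz]]
  unfolding unit_borel_def[symmetric] by (simp cong: measurable_cong_sets)

lemma copula_D1_eq: "copula_D1 (Cs n) C = (\<integral>y. kernel_dist n y \<partial>unit_lebesgue)"
  unfolding copula_D1_def kernel_dist_def
proof (rule Bochner_Integration.integral_cong[OF refl])
  fix y assume "y \<in> space unit_lebesgue"
  then have y: "y \<in> {0..1}" by simp
  note [measurable] = M_cdf_measurable[OF y] seq.M_cdf_measurable[OF y, of n] kernel_diff_measurable[OF y, of n]
  show "(\<integral>x. \<bar>measure (markov_kernel (Cs n) x) {0..y} - measure (M x) {0..y}\<bar> \<partial>unit_lebesgue) =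
      (\<integral>x. \<bar>ks n x y - k x y\<bar> \<partial>unit_lebesgue)"
  proof (rule integral_cong_AE)
    show "AE x in unit_lebesgue. \<bar>measure (markov_kernel (Cs n) x) {0..y} - measure (M x) {0..y}\<bar> =
        \<bar>ks n x y - k x y\<bar>"
      using cop.markov_kernel_cdf[OF y] seq.cop.markov_kernel_cdf[OF y, of n] by eventually_elim simp
  qed measurable
qed

lemma copula_diff_le_kernel_dist:
  assumes x: "x \<in> {0..1}" and y: "y \<in> {0..1}"
  shows "\<bar>Cs n x y - C x y\<bar> \<le> kernel_dist n y"
proof -
  let ?f = "\<lambda>t. ks n t y * indicator {0..x} t - k t y * indicator {0..x} t"
  have hb: "has_bochner_integral unit_lebesgue ?f (Cs n x y - C x y)"
    by (intro has_bochner_integral_diff has_bochner_integral_k seq.has_bochner_integral_k x y)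
  then have "\<bar>Cs n x y - C x y\<bar> = \<bar>\<integral>t. ?f t \<partial>unit_lebesgue\<bar>"
    by (simp add: has_bochner_integral_iff)
  also have "\<dots> \<le> (\<integral>t. \<bar>?f t\<bar> \<partial>unit_lebesgue)"
    by (rule integral_abs_bound)
  also have "\<dots> \<le> kernel_dist n y"
    unfolding kernel_dist_def
  proof (rule integral_mono)
    show "integrable unit_lebesgue (\<lambda>t. \<bar>?f t\<bar>)" using hb by (auto simp: has_bochner_integral_iff)
  qed (use kernel_diff_integrable[OF y] in \<open>auto simp: indicator_def\<close>)
  finally show ?thesis .
qed

lemma copulas_tendsto_if_kernel_dist:
  assumes "x \<in> {0..1}" "y \<in> {0..1}" and lim: "(\<lambda>n. kernel_dist n y) \<longlonglongrightarrow> 0"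
  shows "(\<lambda>n. Cs n x y) \<longlonglongrightarrow> C x y"
proof -
  have "(\<lambda>n. Cs n x y - C x y) \<longlonglongrightarrow> 0"
    by (rule Lim_null_comparison[OF _ lim]) (use copula_diff_le_kernel_dist assms in auto)
  then show ?thesis by (simp add: LIM_zero_iff)
qed

lemma kernel_dist_tendsto:
  assumes y: "y \<in> {0..1}" and conv: "AE x in unit_lebesgue. (\<lambda>n. ks n x y) \<longlonglongrightarrow> k x y"
  shows "(\<lambda>n. kernel_dist n y) \<longlonglongrightarrow> 0"
proof -
  have "(\<lambda>n. \<integral>x. \<bar>ks n x y - k x y\<bar> \<partial>unit_lebesgue) \<longlonglongrightarrow> (\<integral>x. 0 \<partial>unit_lebesgue)"
  proof (rule integral_dominated_convergence[where w = "\<lambda>_. 1"])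
    show "AE x in unit_lebesgue. (\<lambda>n. \<bar>ks n x y - k x y\<bar>) \<longlonglongrightarrow> 0"
      using conv by eventually_elim (simp add: tendsto_rabs_zero_iff LIM_zero)
  qed (use kernel_diff_measurable[OF y] kernel_diff_bound[OF y] in auto)
  then show ?thesis by (simp add: kernel_dist_def)
qed

lemma copulas_tendsto_if_D1:
  assumes D1: "(\<lambda>n. copula_D1 (Cs n) C) \<longlonglongrightarrow> 0" and xy: "x \<in> {0..1}" "y \<in> {0..1}"
  shows "(\<lambda>n. Cs n x y) \<longlonglongrightarrow> C x y"
proof (rule copulas_tendsto_if_kernel_dist[OF xy])
  have "(\<lambda>n. sqrt (8 * copula_D1 (Cs n) C)) \<longlonglongrightarrow> sqrt (8 * 0)"
    by (intro tendsto_intros D1)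
  then have "(\<lambda>n. sqrt (8 * copula_D1 (Cs n) C)) \<longlonglongrightarrow> 0" by simp
  then show "(\<lambda>n. kernel_dist n y) \<longlonglongrightarrow> 0"
  proof (rule Lim_null_comparison[rotated])
    show "\<forall>\<^sub>F n in sequentially. norm (kernel_dist n y) \<le> sqrt (8 * copula_D1 (Cs n) C)"
      using lipschitz_le_sqrt_integral[OF kernel_dist_lipschitz kernel_dist_range xy(2)]
        kernel_dist_range[OF xy(2)] by (simp add: copula_D1_eq)
  qed
qed

text \<open>
  Weak convergence only speaks about continuity points of the limiting distribution function.  For fixed \<open>y\<close> this is no loss,
  because almost no conditional distribution has an atom at \<open>y\<close>.
\<close>

lemma copulas_tendsto_if_wcc:
  assumes wcc: "wcc Cs C" and xy: "x \<in> {0..1}" "y \<in> {0..1}"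
  shows "(\<lambda>n. Cs n x y) \<longlonglongrightarrow> C x y"
proof (rule copulas_tendsto_if_kernel_dist[OF xy], rule kernel_dist_tendsto[OF xy(2)])
  have "AE t in unit_lebesgue. \<forall>n. measure (markov_kernel (Cs n) t) {0..y} = ks n t y"
    using seq.cop.markov_kernel_cdf[OF xy(2)] by (simp add: AE_all_countable)
  with wcc[unfolded wcc_def] M_no_atom[OF xy(2)] cop.markov_kernel_cdf[OF xy(2)] AE_space
  show "AE t in unit_lebesgue. (\<lambda>n. ks n t y) \<longlonglongrightarrow> k t y"
  proof eventually_elim
    case (elim t)
    then have t: "t \<in> {0..1}" by simp
    interpret real_distribution "distr (M t) borel (\<lambda>y. y)" by (rule M_real_distribution[OF t])
    have "isCont (cdf (distr (M t) borel (\<lambda>y. y))) y"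
      using elim measure_singleton_M[OF t xy(2)] by (simp add: isCont_cdf)
    then have "(\<lambda>n. cdf (distr (markov_kernel (Cs n) t) borel (\<lambda>y. y)) y)
        \<longlonglongrightarrow> cdf (distr (M t) borel (\<lambda>y. y)) y"
      using elim by (auto simp: weak_conv_m_def weak_conv_def)
    then show ?case
      using elim xy(2) by (simp add: cdf_M[OF t] seq.cdf_M[OF t])
  qed
qed

context
  assumes conv: "\<And>x. x \<in> {0<..1} \<Longrightarrow> (\<lambda>n. gs n x) \<longlonglongrightarrow> g x"
begin

lemma kernels_tendsto_AE:
  assumes y: "y \<in> {0..1}"
  shows "AE x in unit_lebesgue. (\<lambda>n. ks n x y) \<longlonglongrightarrow> k x y"
proof (rule kernels_tendsto_ae[OF conv y])
  fix N assume "countable N" "\<And>x. x \<in> {0<..<1} - N \<Longrightarrow> (\<lambda>n. ks n x y) \<longlonglongrightarrow> k x y"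
  then show ?thesis by (rule AE_unit_countable)
qed

lemma D1_tendsto: "(\<lambda>n. copula_D1 (Cs n) C) \<longlonglongrightarrow> 0"
proof -
  have "(\<lambda>n. \<integral>y. kernel_dist n y \<partial>unit_lebesgue) \<longlonglongrightarrow> (\<integral>y. 0 \<partial>unit_lebesgue)"
  proof (rule integral_dominated_convergence[where w = "\<lambda>_. 1"])
    show "AE y in unit_lebesgue. (\<lambda>n. kernel_dist n y) \<longlonglongrightarrow> 0"
      using kernel_dist_tendsto kernels_tendsto_AE by (auto intro!: AE_I2)
    show "AE y in unit_lebesgue. norm (kernel_dist n y) \<le> 1" for n
      using kernel_dist_range by (auto intro!: AE_I2)
  qed (use kernel_dist_measurable in auto)
  then show ?thesis by (simp add: copula_D1_eq)
qed

text \<open>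
  Convergence of the distribution functions for each rational \<open>y\<close> and almost every \<open>x\<close> holds for almost every \<open>x\<close> and all rational \<open>y\<close> simultaneously.
\<close>

lemma wcc_tendsto: "wcc Cs C"
  unfolding wcc_def
proof -
  let ?Q = "\<rat> \<inter> {0..1::real}"
  have Q: "countable ?Q" by (rule countable_subset[OF _ countable_rat]) auto
  have "AE x in unit_lebesgue. \<forall>q\<in>?Q. (\<lambda>n. measure (markov_kernel (Cs n) x) {0..q}) \<longlonglongrightarrow> measure (M x) {0..q}"
  proof (subst AE_ball_countable[OF Q], rule ballI)
    fix q assume "q \<in> ?Q"
    then have q: "q \<in> {0..1}" by auto
    have "AE t in unit_lebesgue. \<forall>n. measure (markov_kernel (Cs n) t) {0..q} = ks n t q"
      using seq.cop.markov_kernel_cdf[OF q] by (simp add: AE_all_countable)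
    with kernels_tendsto_AE[OF q] cop.markov_kernel_cdf[OF q]
    show "AE x in unit_lebesgue. (\<lambda>n. measure (markov_kernel (Cs n) x) {0..q}) \<longlonglongrightarrow> measure (M x) {0..q}"
      by eventually_elim simp
  qed
  with AE_space show "AE x in unit_lebesgue. weak_conv_m (\<lambda>n. distr (markov_kernel (Cs n) x) borel (\<lambda>y. y))
      (distr (M x) borel (\<lambda>y. y))"
  proof eventually_elim
    case (elim t)
    then have t: "t \<in> {0..1}" by simp
    note 1 = M_total[OF t] seq.M_total[OF t]
    let ?F = "cdf (distr (M t) borel (\<lambda>y. y))"
      and ?Fs = "\<lambda>n. cdf (distr (markov_kernel (Cs n) t) borel (\<lambda>y. y))"
    have "(\<lambda>n. ?Fs n y) \<longlonglongrightarrow> ?F y" if "isCont ?F y" for y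
    proof (rule tendsto_of_dense[of ?Fs ?F y, OF _ _ that])
      show "mono (cdf (distr (markov_kernel (Cs n) t) borel (\<lambda>y. y)))" for n
      proof -
        interpret real_distribution "distr (markov_kernel (Cs n) t) borel (\<lambda>y. y)"
          by (rule seq.M_real_distribution[OF t])
        show ?thesis using cdf_nondecreasing by (simp add: mono_def)
      qed
      fix q :: real assume q: "q \<in> \<rat>"
      show "(\<lambda>n. cdf (distr (markov_kernel (Cs n) t) borel (\<lambda>y. y)) q)
          \<longlonglongrightarrow> cdf (distr (M t) borel (\<lambda>y. y)) q"
      proof (cases "q < 0 \<or> 1 \<le> q")
        case True
        then show ?thesis
        proof
          assume "1 \<le> q"
          then have "\<not> q < 0" "min q 1 = 1" by simp_all
          then show ?thesis by (simp only: cdf_M[OF t] seq.cdf_M[OF t] 1 if_False tendsto_const)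
        qed (simp only: cdf_M[OF t] seq.cdf_M[OF t] if_True tendsto_const)
      next
        case False
        then have "q \<in> ?Q" "\<not> q < 0" "min q 1 = q" using q by simp_all
        with elim show ?thesis by (simp only: cdf_M[OF t] seq.cdf_M[OF t] if_False)
      qed
    qed
    then show ?case
      unfolding weak_conv_m_def weak_conv_def by blast
  qed
qed

end

end

lemma all_equivalentI: "(\<And>P. P \<in> set Ps \<Longrightarrow> P = Q) \<Longrightarrow> all_equivalent Ps"
  unfolding all_equivalent_def by blast

theorem theorem4p2:
  fixes \<phi> :: "real \<Rightarrow> ennreal" and \<phi>s :: "nat \<Rightarrow> real \<Rightarrow> ennreal"
    and C :: "real \<Rightarrow> real \<Rightarrow> real" and Cs :: "nat \<Rightarrow> real \<Rightarrow> real \<Rightarrow> real"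
  assumes "generator \<phi>" and "\<And>n. generator (\<phi>s n)"
    and "C = arch_copula \<phi>" and "\<And>n. Cs n = arch_copula (\<phi>s n)"
  shows "all_equivalent
    [\<forall>x\<in>{0..1}. \<forall>y\<in>{0..1}. (\<lambda>n. Cs n x y) \<longlonglongrightarrow> C x y,
     \<forall>x\<in>cont_right_deriv \<phi>. (\<lambda>n. kendall_cdf (Cs n) x) \<longlonglongrightarrow> kendall_cdf C x,
     \<forall>x\<in>{0<..1}. (\<lambda>n. \<phi>s n x) \<longlonglongrightarrow> \<phi> x,
     \<forall>x\<in>cont_right_deriv \<phi>. (\<lambda>n. right_deriv (\<phi>s n) x) \<longlonglongrightarrow> right_deriv \<phi> x,
     (\<lambda>n. copula_D1 (Cs n) C) \<longlonglongrightarrow> 0,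
     wcc Cs C]" (is "all_equivalent [?a, ?b, ?c, ?d, ?e, ?f]")
proof -
  interpret generator_sequence \<phi> \<phi>s
    using assms(1,2) by unfold_locales
  have C: "C = arch_copula \<phi>" and Cs: "Cs = (\<lambda>n. arch_copula (\<phi>s n))"
    using assms(3,4) by auto
  have c: "?c \<longleftrightarrow> (\<forall>x\<in>{0<..1}. (\<lambda>n. gen_fun (\<phi>s n) x) \<longlonglongrightarrow> gen_fun \<phi> x)"
    using generator_tendsto_iff by blast
  have b: "?b \<longleftrightarrow> (\<forall>x\<in>cont_right_deriv \<phi>. (\<lambda>n. kendall_formula (\<phi>s n) x) \<longlonglongrightarrow> kendall_formula \<phi> x)"
    unfolding C Cs
    by (intro ball_cong refl) (simp add: kendall_cdf_eq seq.kendall_cdf_eq cont_right_deriv_def)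
  have "?a \<longleftrightarrow> ?c"
    unfolding c C Cs using generators_tendsto_if_copulas copulas_tendsto by blast
  moreover have "?b \<longleftrightarrow> ?c"
    unfolding b c using generators_tendsto_if_kendall kendall_tendsto by blast
  moreover have "?d \<longleftrightarrow> ?c"
    unfolding c using generators_tendsto_if_derivatives derivatives_tendsto_const by blast
  moreover have "?c \<Longrightarrow> ?e" "?c \<Longrightarrow> ?f"
    unfolding c C Cs using D1_tendsto wcc_tendsto by blast+
  moreover have "?e \<Longrightarrow> ?a" "?f \<Longrightarrow> ?a"
    unfolding C Cs using copulas_tendsto_if_D1 copulas_tendsto_if_wcc by blast+
  ultimately have "?a = ?c" "?b = ?c" "?d = ?c" "?e = ?c" "?f = ?c" by argo+
  then show ?thesis
    by (intro all_equivalentI[of _ ?c]) (simp only: list.set insert_iff empty_iff, elim disjE, simp_all only:)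
qed

end
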